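(* Let $n$ be a positive integer with $n\equiv 3\pmod 4$, and let $a,b$ be indeterminates. Then, modulo $[n](1-aq^n)(a-q^n)(b-q^n)$, \[ \sum_{k=0}^{n-1}[6k+1]\frac{(q,aq,q/a;q^2)_k(q/b^3;q^4)_k}{(q^4,q^4/a,aq^4;q^4)_k(b^3q^2;q^2)_k}q^{k^2+k}b^{3k} \equiv \frac{(b-q^n)(ab-1-a^2+aq^n)}{(a-b)(1-ab)}\frac{(q^3,1/b^3;q^4)_{(n+1)/4}}{(1/q,b^3q^2;q^4)_{(n+1)/4}}\bigg(\frac{b^3}{q}\bigg)^{\frac{n+1}{4}} +\frac{(1-aq^n)(a-q^n)}{(a-b)(1-ab)}\frac{(q^3,q^5;q^4)_{(3n-1)/4}}{(aq^4,q^4/a;q^4)_{(3n-1)/4}}. \]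
   Context: For $x$ and integer $n\ge 0$, $(x;q)_n=\prod_{j=0}^{n-1}(1-xq^j)$, and $(x_1,\dots,x_m;q)_n=(x_1;q)_n\cdots(x_m;q)_n$. $[r]=(1-q^r)/(1-q)$ is the $q$-integer. A congruence modulo a polynomial $P$ in $q,a,b$ between rational functions whose denominators are coprime to $P$ means that the difference is a rational function whose numerator is divisible by $P$ and whose denominator is coprime to $P$. *)

theory Defs
  imports "HOL-Computational_Algebra.Computational_Algebra"
begin

text \<open>
  Polynomials in \<open>q, a, b\<close> are modelled as \<open>\<rat>[q][a][b]\<close> and rational functions as
  its field of fractions, so \<open>q\<close>, \<open>a\<close>, \<open>b\<close> are independent indeterminates.
\<close>

type_synonym qab_poly = "rat poly poly poly"
type_synonym qab_ratfun = "qab_poly fract"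

definition q_poly :: qab_poly where "q_poly = [:[:[:0, 1:]:]:]"
definition a_poly :: qab_poly where "a_poly = [:[:0, 1:]:]"
definition b_poly :: qab_poly where "b_poly = [:0, 1:]"

definition qpoch :: "'a::comm_ring_1 \<Rightarrow> 'a \<Rightarrow> nat \<Rightarrow> 'a" where
  "qpoch x q n = (\<Prod>j<n. 1 - x * q ^ j)"

text \<open>
  In a field \<open>div\<close> is the same constant as \<open>/\<close>.  In a polynomial ring the division below
  is exact for \<open>q \<noteq> 1\<close>, so the same definition serves both the \<open>q\<close>-integers in the summands
  and the one in the modulus.
\<close>

definition qint :: "'a::idom_divide \<Rightarrow> nat \<Rightarrow> 'a" where
  "qint q r = (1 - q ^ r) div (1 - q)"

text \<open>
  Having denominator coprime to \<open>P\<close> is a property of the rational function, not of the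
  expression denoting it: some (equivalently, the reduced) fraction representing it has
  such a denominator.
\<close>

definition coprime_denom :: "qab_poly \<Rightarrow> qab_ratfun \<Rightarrow> bool" where
  "coprime_denom P x \<longleftrightarrow> (\<exists>N D. D \<noteq> 0 \<and> coprime D P \<and> x = Fract N D)"

definition ratfun_cong :: "qab_ratfun \<Rightarrow> qab_ratfun \<Rightarrow> qab_poly \<Rightarrow> bool" where
  "ratfun_cong x y P \<longleftrightarrow> coprime_denom P x \<and> coprime_denom P y \<and>
     (\<exists>N D. D \<noteq> 0 \<and> coprime D P \<and> P dvd N \<and> x - y = Fract N D)"

end

theory Submission
  imports Defs "HOL-Computational_Algebra.Field_as_Ring"
begin

text \<open>
  The summand is \<open>1 / (1 - q)\<close> times the summand \<open>quad_term q q (a q) (b\<^sup>3)\<close> of Rahman's quadratic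
  summation.  In its terminating cases that summation follows from three telescoping relations which
  shift one parameter by \<open>q\<^sup>4\<close>.  At \<open>b = q\<^sup>n\<close> and at \<open>a = q\<^sup>n\<close> or \<open>a = q\<^sup>-\<^sup>n\<close> it evaluates
  the sum, and the two coefficients on the right-hand side, which add up to \<open>1\<close>, glue the values together.
  For a prime \<open>p\<close> dividing \<open>[n]\<close>, let \<open>d\<close> be the order of \<open>q\<close> modulo \<open>p\<close>.  The sum splits into blocks of
  length \<open>d\<close>, each a multiple of the first one modulo \<open>p\<close>; the first block is congruent to the sum with
  the leading parameter \<open>q\<close> replaced by \<open>q\<^sup>1\<^sup>-\<^sup>d\<close>, which vanishes identically.
  As the modulus is squarefree, it suffices to work in the localization at each of its primes.
\<close>

section \<open>Shifted factorials and telescoping relations\<close>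

text \<open>The residue class of n makes the series terminate. Put n + 1 = 4m and 3n - 1 = 4M. At b
  = q^n the parameter q/b^3 becomes q^(-4M); at a = q^n or a = q^(-n) one of q/a, aq becomes
  q^(2-4m). Since M < n and 2m - 1 < n, the range of summation contains all nonzero terms. These
  substitutions are congruences inside the field of rational functions, where q is never a root of
  unity, so the summations can be applied there as exact identities. The primes p dividing [n] cause
  two difficulties. For k at least d the denominator (q^4;q^4)_k has factors divisible by p, so that
  even the integrality of the summands has to be proved. On the other side (1/q;q^4)_m may have such
  factors as well, and they must be cancelled against (q^3;q^4)_m. The exponent 1 - d is even
  because d divides the odd number n; therefore q^(1-d) is a power of 1/q^2 and terminates a series
  in base q^2, while the base itself stays generic.\<close>

lemma qpoch_0 [simp]: "qpoch x q 0 = 1"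
  by (simp add: qpoch_def)

lemma qpoch_Suc: "qpoch x q (Suc n) = qpoch x q n * (1 - x * q ^ n)"
  by (simp add: qpoch_def)

lemma qpoch_shift: "(1 - x) * qpoch (x * q) q n = qpoch x q n * (1 - x * q ^ n)"
proof (induction n)
  case (Suc n)
  have "(1 - x) * qpoch (x * q) q (Suc n) = ((1 - x) * qpoch (x * q) q n) * (1 - x * q * q ^ n)"
    by (simp add: qpoch_Suc mult.assoc)
  also have "\<dots> = qpoch x q (Suc n) * (1 - x * q ^ Suc n)"
    unfolding Suc.IH by (simp add: qpoch_Suc mult_ac)
  finally show ?case .
qed simp

lemma qpoch_shift2:
  "(1 - x) * (1 - x * q) * qpoch (x * q ^ 2) q n = qpoch x q n * (1 - x * q ^ n) * (1 - x * q * q ^ n)"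
proof -
  have "(1 - x) * (1 - x * q) * qpoch (x * q ^ 2) q n = (1 - x) * ((1 - x * q) * qpoch (x * q * q) q n)"
    by (simp only: power2_eq_square mult.assoc)
  also have "\<dots> = (1 - x) * qpoch (x * q) q n * (1 - x * q * q ^ n)"
    unfolding qpoch_shift[of "x * q"] by (simp only: mult.assoc)
  finally show ?thesis
    unfolding qpoch_shift by (simp only: mult.assoc)
qed

lemma qpoch_eq_0: "j < n \<Longrightarrow> x * q ^ j = 1 \<Longrightarrow> qpoch x q n = 0"
  unfolding qpoch_def by (rule prod_zero) auto

lemma qpoch_nonzero:
  fixes x :: "'a::idom"
  shows "(\<And>j. j < n \<Longrightarrow> x * q ^ j \<noteq> 1) \<Longrightarrow> qpoch x q n \<noteq> 0"
  by (auto simp: qpoch_def)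

text \<open>The summand has \<open>C = q\<^sup>2 / B\<close> and \<open>D = A / E\<close>, but the three telescoping relations need
  numerators in which some of the four parameters are shifted independently.\<close>

definition quad_core :: "'a::field \<Rightarrow> 'a \<Rightarrow> 'a \<Rightarrow> 'a \<Rightarrow> 'a \<Rightarrow> 'a \<Rightarrow> nat \<Rightarrow> 'a" where
  "quad_core q A B C D E k =
     qpoch A (q ^ 2) k * qpoch B (q ^ 2) k * qpoch C (q ^ 2) k * qpoch D (q ^ 4) k
     * q ^ (k ^ 2 + k) * E ^ k"

definition quad_den :: "'a::field \<Rightarrow> 'a \<Rightarrow> 'a \<Rightarrow> 'a \<Rightarrow> nat \<Rightarrow> 'a" where
  "quad_den q F G E k =
     qpoch (q ^ 4) (q ^ 4) k * qpoch F (q ^ 4) k * qpoch G (q ^ 4) k * qpoch (E * q ^ 2) (q ^ 2) k"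

definition quad_term :: "'a::field \<Rightarrow> 'a \<Rightarrow> 'a \<Rightarrow> 'a \<Rightarrow> nat \<Rightarrow> 'a" where
  "quad_term q A B E k = (1 - A * q ^ (6 * k)) * quad_core q A B (q ^ 2 / B) (A / E) E k
     / quad_den q (A * q ^ 4 / B) (A * B * q ^ 2) E k"

lemma quad_core_Suc:
  "quad_core q A B C D E (Suc k) = quad_core q A B C D E k *
    ((1 - A * q ^ (2 * k)) * (1 - B * q ^ (2 * k)) * (1 - C * q ^ (2 * k)) * (1 - D * (q ^ (2 * k)) ^ 2)
      * (E * q ^ 2 * q ^ (2 * k)))"
proof -
  have "q ^ ((Suc k) ^ 2 + Suc k) = q ^ (k ^ 2 + k) * (q ^ 2 * q ^ (2 * k))"
    unfolding power_add[symmetric] by (rule arg_cong[of _ _ "(^) q"]) (simp add: power2_eq_square)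
  moreover have "(q ^ 4) ^ k = (q ^ (2 * k)) ^ 2" "(q ^ 2) ^ k = q ^ (2 * k)"
    by (simp_all flip: power_mult)
  ultimately show ?thesis
    by (simp add: quad_core_def qpoch_Suc mult_ac)
qed

lemma quad_den_Suc:
  "quad_den q F G E (Suc k) = quad_den q F G E k *
    ((1 - q ^ 4 * (q ^ (2 * k)) ^ 2) * (1 - F * (q ^ (2 * k)) ^ 2) * (1 - G * (q ^ (2 * k)) ^ 2)
      * (1 - E * q ^ 2 * q ^ (2 * k)))"
proof -
  have "(q ^ 4) ^ k = (q ^ (2 * k)) ^ 2" "(q ^ 2) ^ k = q ^ (2 * k)"
    by (simp_all flip: power_mult)
  then show ?thesis
    by (simp add: quad_den_def qpoch_Suc mult_ac)
qed

lemma quad_den_SucD: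
  assumes "quad_den q F G E (Suc k) \<noteq> 0"
  shows "1 - q ^ 4 * (q ^ (2 * k)) ^ 2 \<noteq> 0" "1 - F * (q ^ (2 * k)) ^ 2 \<noteq> 0"
    "1 - G * (q ^ (2 * k)) ^ 2 \<noteq> 0" "1 - E * q ^ 2 * q ^ (2 * k) \<noteq> 0"
  using assms unfolding quad_den_Suc by auto

text \<open>Writing \<open>w\<close> for q^2/B keeps everything polynomial, so that
  \<open>algebra\<close> can work modulo the single relation \<open>B * w = q ^ 2\<close>. The left
  side comes from the two summands, the right side from the difference of two consecutive
  certificate values.\<close>

lemma shift_param_identity:
  fixes q u x E B w :: "'a::field"
  assumes "B * w = q ^ 2"
  shows "(1-x*E*q^4*u^3)*((1-E*B*q^2)*(1-E*q^2*w)*(1-x)*u^2 - (1-x*u^2)*(1-E*q^2*u)*(1-E*q^4*u))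
    = (1-x*u^2)*(1-x*E*q^4*u)*(1-B*u)*(1-w*u)*E*q^2*u
    - (1-u^2)*(1-x*E*q^2*u^2*w)*(1-x*E*q^2*B*u^2)*(1-E*q^4*u)"
  using assms by algebra

lemma shift_base_identity:
  fixes q u z E B w :: "'a::field"
  assumes "B * w = q ^ 2"
  shows "(1-z)*(1-z*E*u^3)*(1-z*E*q^2*w*u^2)*(1-z*E*q^2*B*u^2)
      - (1-z*E*q^4*u^3)*(1-z*E*u)*(1-z*E*q^2*u)*(1-z*u^2)
    = (1-z*E*u)*(1-B*u)*(1-w*u)*(1-z*u^2)*E*q^2*u*z
      - (1-u^2)*(1-z*E*q^2*w*u^2)*(1-z*E*q^2*B*u^2)*z*(1-E*u)"
  using assms by algebra

lemma shift_numer_identity: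
  fixes q u x E A :: "'a::field"
  shows "(x-E)*(1-A*u^3)*(x*q^2-u)*(x-u)*(1-A*x*q^2*u^2)
      - (1-E*x*q^2)*(1-A*u^3)*(1-x*u)*(1-x*q^2*u)*(x-A*u^2)
    = (1-x^2*q^2)*((1-A*u)*(1-x*u)*(x*q^2-u)*(E-A*u^2)*u - (1-u^2)*(1-A*x*q^2*u^2)*(1-E*u)*(x-A*u^2))"
  by algebra

text \<open>In this relation and the next two, \<open>G\<close> is the certificate of creative telescoping; divided by the
  summand it is a rational function of \<open>u = q\<^sup>2\<^sup>k\<close>, and the polynomial identities above are
  the resulting first-order recurrences in \<open>k\<close> with denominators cleared.\<close>

lemma quad_term_shift_param:
  fixes q A B E x :: "'a::field"
  defines "y \<equiv> (1 - E * q ^ 2) * (1 - E * q ^ 4)"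
  defines "G \<equiv> (\<lambda>k. quad_core q A B (q ^ 2 / B) x E k / quad_den q (A * q ^ 4 / B) (A * B * q ^ 2) E k
    * ((1 - (q ^ (2 * k)) ^ 2) * (1 - A * (q ^ (2 * k)) ^ 2 / B) * (1 - A * B * (q ^ (2 * k)) ^ 2 / q ^ 2) * y
       / ((1 - x) * (1 - E * q ^ 2 * q ^ (2 * k)))))"
  assumes A: "A = x * E * q ^ 4" and nz: "q \<noteq> 0" "B \<noteq> 0" "E \<noteq> 0" "x \<noteq> 1"
    and den: "\<And>k. quad_den q (A * q ^ 4 / B) (A * B * q ^ 2) E k \<noteq> 0"
  shows "(1 - E * B * q ^ 2) * (1 - E * q ^ 4 / B) * (\<Sum>k<K. quad_term q A B (E * q ^ 4) k)
    - y * (\<Sum>k<K. quad_term q A B E k) = G K"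
proof (induction K)
  case 0
  then show ?case by (simp add: G_def)
next
  case (Suc k)
  define u where "u = q ^ (2 * k)"
  define w where "w = q ^ 2 / B"
  define F where "F = A * q ^ 4 / B"
  define H where "H = A * B * q ^ 2"
  define e1 where "e1 = 1 - E * q ^ 2 * u"
  define e2 where "e2 = 1 - E * q ^ 4 * u"
  define C where "C = quad_core q A B w x E k / quad_den q F H E k"
  \<comment> \<open>Both summands, \<open>G k\<close> and \<open>G (Suc k)\<close> are
    \<open>cf\<close> times a polynomial in \<open>u\<close>; removing \<open>cf\<close> leaves
    \<open>shift_param_identity\<close>.\<close>
  define cf where "cf = C * y / ((1 - x) * (e1 * e2))"
  have u3: "q ^ (6 * k) = u ^ 3" and u2: "q ^ (4 * k) = u ^ 2"
    by (simp_all add: u_def flip: power_mult)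
  have qk: "(q ^ 4) ^ k = u ^ 2" "(q ^ 2) ^ k = u"
    by (simp_all add: u_def flip: power_mult)
  have e1: "e1 \<noteq> 0" and f1: "1 - q ^ 4 * u\<^sup>2 \<noteq> 0" "1 - F * u\<^sup>2 \<noteq> 0" "1 - H * u\<^sup>2 \<noteq> 0"
    using quad_den_SucD[OF den[of "Suc k"]] by (simp_all add: e1_def u_def F_def H_def)
  have qu: "q ^ (2 * Suc k) = q ^ 2 * u" by (simp add: u_def flip: power_add)
  have Eq4: "E * q ^ 4 = E * q ^ 2 * q ^ 2" by (simp flip: power_add)
  \<comment> \<open>A shift by q^4 is two steps in base q^2, so this factor first occurs in the
    denominator two indices later.\<close>
  have e2: "e2 \<noteq> 0"
    using quad_den_SucD(4)[OF den[of "Suc (Suc k)"]] unfolding qu e2_def Eq4 by (simp add: mult.assoc)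
  have y: "y \<noteq> 0"
    using quad_den_SucD(4)[OF den[of "Suc 0"]] quad_den_SucD(4)[OF den[of "Suc (Suc 0)"]]
    unfolding y_def Eq4 by simp
  have Bw: "B * w = q ^ 2"
    using nz by (simp add: w_def)
  have x1: "1 - x \<noteq> 0" using nz by simp
  have AE: "A / (E * q ^ 4) = x"
    using A nz by simp
  have core1: "quad_core q A B w (A / (E * q ^ 4)) (E * q ^ 4) k = quad_core q A B w x E k * u ^ 2"
    by (simp add: AE quad_core_def power_mult_distrib qk)
  have core2: "quad_core q A B w (A / E) E k = quad_core q A B w x E k * (1 - x * u ^ 2) / (1 - x)"
  proof -
    have "A / E = x * q ^ 4" using A nz by simp
    moreover have "qpoch (x * q ^ 4) (q ^ 4) k = qpoch x (q ^ 4) k * (1 - x * u ^ 2) / (1 - x)"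
      using qpoch_shift[of x "q ^ 4" k] x1 by (simp add: field_simps qk)
    ultimately show ?thesis by (simp add: quad_core_def)
  qed
  have den1: "y * quad_den q F H (E * q ^ 4) k = quad_den q F H E k * (e1 * e2)"
  proof -
    have "E * q ^ 2 * (q ^ 2) ^ 2 = E * q ^ 4 * q ^ 2"
      by (simp add: mult.assoc flip: power_mult power_add)
    then have "y * qpoch (E * q ^ 4 * q ^ 2) (q ^ 2) k = qpoch (E * q ^ 2) (q ^ 2) k * (e1 * e2)"
      using qpoch_shift2[of "E * q ^ 2" "q ^ 2" k]
      unfolding qk Eq4[symmetric] y_def e1_def e2_def by (simp only: mult.assoc)
    then show ?thesis
      unfolding quad_den_def by algebra
  qed
  have T1: "(1 - E * B * q ^ 2) * (1 - E * q ^ 4 / B) * quad_term q A B (E * q ^ 4) k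
      = cf * ((1 - A * u ^ 3) * ((1 - E * B * q ^ 2) * (1 - E * q ^ 2 * w) * (1 - x) * u ^ 2))"
  proof -
    have "quad_den q F H (E * q ^ 4) k = quad_den q F H E k * (e1 * e2) / y"
      using den1 y by (simp add: field_simps)
    then have "quad_term q A B (E * q ^ 4) k = (1 - A * u ^ 3) * (C * u ^ 2 * y / (e1 * e2))"
      unfolding quad_term_def F_def[symmetric] H_def[symmetric] w_def[symmetric] core1 u3
      by (simp add: C_def)
    moreover have "E * q ^ 4 / B = E * q ^ 2 * w"
      by (simp add: w_def flip: power_add)
    ultimately show ?thesis
      using x1 by (simp add: cf_def)
  qed
  have T2: "y * quad_term q A B E k = cf * ((1 - A * u ^ 3) * ((1 - x * u ^ 2) * e1 * e2))"
    unfolding quad_term_def F_def[symmetric] H_def[symmetric] w_def[symmetric] core2 u3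
    using e1 e2 by (simp add: C_def cf_def mult_ac)
  have G1: "G k = cf * ((1-u^2)*(1-x*E*q^2*u^2*w)*(1-x*E*q^2*B*u^2)*e2)"
  proof -
    have "A * u\<^sup>2 / B = x*E*q^2*u^2*w"
      using nz by (simp add: A w_def field_simps flip: power_add)
    moreover have "A * B * u\<^sup>2 / q\<^sup>2 = x*E*q^2*B*u^2"
      using nz by (simp add: A field_simps flip: power_add)
    ultimately show ?thesis
      unfolding G_def F_def[symmetric] H_def[symmetric] w_def[symmetric] u_def[symmetric]
      using e2 by (simp add: C_def cf_def e1_def mult_ac)
  qed
  have G2: "G (Suc k) = cf * ((1-x*u^2)*(1-A*u)*(1-B*u)*(1-w*u)*E*q^2*u)"
  proof -
    define d where "d = (1 - q ^ 4 * u\<^sup>2) * (1 - F * u\<^sup>2) * (1 - H * u\<^sup>2)"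
    have d: "d \<noteq> 0" using f1 by (simp add: d_def)
    note qu
    moreover have "1 - (q ^ 2 * u)\<^sup>2 = 1 - q ^ 4 * u\<^sup>2"
      by (simp add: power_mult_distrib flip: power_mult)
    moreover have "A * (q ^ 2 * u)\<^sup>2 / B = F * u\<^sup>2"
      by (simp add: F_def power_mult_distrib flip: power_mult)
    moreover have "A * B * (q ^ 2 * u)\<^sup>2 / q\<^sup>2 = H * u\<^sup>2"
      using nz by (simp add: H_def power2_eq_square)
    moreover have "1 - E * q\<^sup>2 * (q ^ 2 * u) = e2"
      by (simp add: e2_def mult_ac flip: power_add mult.assoc)
    ultimately have "G (Suc k) = (quad_core q A B w x E k * ((1-A*u)*(1-B*u)*(1-w*u)*(1-x*u^2)*(E*q^2*u)))
       / (quad_den q F H E k * (d * e1)) * (d * y / ((1 - x) * e2))"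
      unfolding G_def F_def[symmetric] H_def[symmetric] w_def[symmetric] quad_core_Suc quad_den_Suc u_def[symmetric]
      by (simp add: d_def e1_def)
    also have "\<dots> = cf * ((1-x*u^2)*(1-A*u)*(1-B*u)*(1-w*u)*E*q^2*u)"
      using d e1 e2 x1 by (simp add: C_def cf_def mult_ac)
    finally show ?thesis .
  qed
  have "(1 - E * B * q ^ 2) * (1 - E * q ^ 4 / B) * quad_term q A B (E * q ^ 4) k
      - y * quad_term q A B E k = G (Suc k) - G k"
    unfolding T1 T2 G1 G2 right_diff_distrib[symmetric]
    using shift_param_identity[OF Bw, of x E u, folded A] by (simp add: e1_def e2_def)
  then show ?case
    unfolding sum.lessThan_Suc distrib_left add_diff_add Suc.IH by simp
qed


text \<open>Raising x by q^4 moves (x;q^2)_k two steps and the factorials of \<open>F\<close>,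
  \<open>H\<close> and x/E one step each. The prefactors (1 - x)(1 - xq^2) and (1 - F)(1 - H) clear
  the quotients that arise. The certificate vanishes at k = 0, so the boundary at K is all that
  remains.\<close>

lemma quad_term_shift_base:
  fixes q B E x z :: "'a::field"
  defines "F \<equiv> x * q ^ 4 / B" and "H \<equiv> x * B * q ^ 2"
  defines "G \<equiv> (\<lambda>k. quad_core q x B (q ^ 2 / B) z E k / quad_den q F H E k
    * ((1 - F) * (1 - H) * z * (1 - (q ^ (2 * k)) ^ 2) * (1 - E * q ^ (2 * k)) / (1 - z)))"
  assumes x: "x = z * E" and nz: "q \<noteq> 0" "B \<noteq> 0" "E \<noteq> 0" "z \<noteq> 1"
    and den: "\<And>k. quad_den q F H E k \<noteq> 0"
  shows "(1 - F) * (1 - H) * (\<Sum>k<K. quad_term q x B E k)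
    - (1 - x) * (1 - x * q ^ 2) * (\<Sum>k<K. quad_term q (x * q ^ 4) B E k) = G K"
proof (induction K)
  case 0
  then show ?case by (simp add: G_def)
next
  case (Suc k)
  define u where "u = q ^ (2 * k)"
  define w where "w = q ^ 2 / B"
  define C where "C = quad_core q x B w z E k / quad_den q F H E k"
  define f where "f = 1 - F * u ^ 2"
  define h where "h = 1 - H * u ^ 2"
  define cf where "cf = C * ((1 - F) * (1 - H)) / ((1 - z) * (f * h))"
  have u3: "q ^ (6 * k) = u ^ 3"
    by (simp add: u_def flip: power_mult)
  have qk: "(q ^ 4) ^ k = u ^ 2" "(q ^ 2) ^ k = u"
    by (simp_all add: u_def flip: power_mult)
  have qu: "q ^ (2 * Suc k) = q ^ 2 * u" by (simp add: u_def flip: power_add)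
  have f: "f \<noteq> 0" and h: "h \<noteq> 0" and e: "1 - q ^ 4 * u\<^sup>2 \<noteq> 0" "1 - E * q ^ 2 * u \<noteq> 0"
    using quad_den_SucD[OF den[of "Suc k"]] by (simp_all add: f_def h_def u_def)
  have f0: "1 - F \<noteq> 0" and h0: "1 - H \<noteq> 0"
    using quad_den_SucD[OF den[of "Suc 0"]] by simp_all
  have Bw: "B * w = q ^ 2"
    using nz by (simp add: w_def)
  have z1: "1 - z \<noteq> 0" using nz by simp
  have T1: "(1 - F) * (1 - H) * quad_term q x B E k = cf * ((1-z)*(1-x*u^3)*f*h)"
  proof -
    have "x / E = z" using x nz by simp
    then show ?thesis
      unfolding quad_term_def F_def[symmetric] H_def[symmetric] w_def[symmetric] u3
      using f h z1
      by (simp add: C_def cf_def mult_ac)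
  qed
  have T2: "(1 - x) * (1 - x * q ^ 2) * quad_term q (x * q ^ 4) B E k
      = cf * ((1-x*q^4*u^3)*(1-x*u)*(1-x*q^2*u)*(1-z*u^2))"
  proof -
    have a: "(1 - x) * (1 - x * q\<^sup>2) * qpoch (x * q ^ 4) (q ^ 2) k
        = qpoch x (q ^ 2) k * (1 - x * u) * (1 - x * q ^ 2 * u)"
      using qpoch_shift2[of x "q ^ 2" k] by (simp add: qk)
    have "x * q ^ 4 / E = z * q ^ 4" using x nz by simp
    moreover have "qpoch (z * q ^ 4) (q ^ 4) k = qpoch z (q ^ 4) k * (1 - z * u ^ 2) / (1 - z)"
      using qpoch_shift[of z "q ^ 4" k] z1 by (simp add: field_simps qk)
    ultimately have "(1 - x) * (1 - x * q ^ 2) * quad_core q (x * q ^ 4) B w (x * q ^ 4 / E) E k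
      = ((1 - x) * (1 - x * q\<^sup>2) * qpoch (x * q ^ 4) (q ^ 2) k) * qpoch B (q ^ 2) k * qpoch w (q ^ 2) k
        * (qpoch z (q ^ 4) k * (1 - z * u ^ 2) / (1 - z)) * q ^ (k ^ 2 + k) * E ^ k"
      unfolding quad_core_def by simp
    also have "\<dots> = quad_core q x B w z E k * ((1-x*u)*(1-x*q^2*u)*(1-z*u^2) / (1 - z))"
      unfolding a quad_core_def by simp
    finally have core: "(1 - x) * (1 - x * q ^ 2) * quad_core q (x * q ^ 4) B w (x * q ^ 4 / E) E k
      = quad_core q x B w z E k * ((1-x*u)*(1-x*q^2*u)*(1-z*u^2) / (1 - z))" .
    have "(1 - F) * (1 - H) * quad_den q (F * q ^ 4) (H * q ^ 4) E k
       = quad_den q F H E k * (f * h)"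
      using qpoch_shift[of F "q ^ 4" k] qpoch_shift[of H "q ^ 4" k]
      unfolding quad_den_def f_def h_def qk by algebra
    then have "quad_den q (F * q ^ 4) (H * q ^ 4) E k
       = quad_den q F H E k * (f * h) / ((1 - F) * (1 - H))"
      using f0 h0 by (simp add: eq_divide_eq mult_ac)
    then have den1: "quad_den q (x * q ^ 4 * q ^ 4 / B) (x * q ^ 4 * B * q ^ 2) E k
       = quad_den q F H E k * (f * h) / ((1 - F) * (1 - H))"
      by (simp add: F_def H_def mult_ac)
    have "(1 - x) * (1 - x * q ^ 2) * quad_term q (x * q ^ 4) B E k
      = (1 - x * q ^ 4 * u ^ 3) * ((1 - x) * (1 - x * q ^ 2) * quad_core q (x * q ^ 4) B w (x * q ^ 4 / E) E k)
       / (quad_den q F H E k * (f * h) / ((1 - F) * (1 - H)))"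
      unfolding quad_term_def w_def[symmetric] u3 den1 by simp
    also have "\<dots> = cf * ((1-x*q^4*u^3)*(1-x*u)*(1-x*q^2*u)*(1-z*u^2))"
      unfolding core by (simp add: C_def cf_def mult_ac)
    finally show ?thesis .
  qed
  have G1: "G k = cf * ((1-u^2)*f*h*z*(1-E*u))"
    unfolding G_def w_def[symmetric] u_def[symmetric]
    using f h by (simp add: C_def cf_def mult_ac)
  have G2: "G (Suc k) = cf * ((1-x*u)*(1-B*u)*(1-w*u)*(1-z*u^2)*E*q^2*u*z)"
  proof -
    define d where "d = (1 - q ^ 4 * u\<^sup>2) * (1 - E * q ^ 2 * u)"
    have d: "d \<noteq> 0" using e by (simp add: d_def)
    have "1 - (q ^ 2 * u)\<^sup>2 = 1 - q ^ 4 * u\<^sup>2"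
      by (simp add: power_mult_distrib flip: power_mult)
    then have "G (Suc k) = (quad_core q x B w z E k * ((1-x*u)*(1-B*u)*(1-w*u)*(1-z*u^2)*(E*q^2*u)))
       / (quad_den q F H E k * (d * (f * h))) * (d * ((1 - F) * (1 - H) * z) / (1 - z))"
      unfolding G_def w_def[symmetric] quad_core_Suc quad_den_Suc u_def[symmetric] qu
      by (simp add: d_def f_def h_def mult_ac)
    also have "\<dots> = cf * ((1-x*u)*(1-B*u)*(1-w*u)*(1-z*u^2)*E*q^2*u*z)"
      using d by (simp add: C_def cf_def mult_ac)
    finally show ?thesis .
  qed
  have fh: "f = 1 - z*E*q^2*w*u^2" "h = 1 - z*E*q^2*B*u^2"
    using nz by (simp_all add: f_def h_def F_def H_def x w_def mult_ac flip: power_add)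
  have "(1 - F) * (1 - H) * quad_term q x B E k
      - (1 - x) * (1 - x * q ^ 2) * quad_term q (x * q ^ 4) B E k = G (Suc k) - G k"
    unfolding T1 T2 G1 G2 right_diff_distrib[symmetric]
    unfolding fh x shift_base_identity[OF Bw] ..
  then show ?case
    unfolding sum.lessThan_Suc distrib_left add_diff_add Suc.IH by simp
qed

text \<open>When B rises from x to xq^4, the parameter AB q^2 rises too, but q^2/B and Aq^4/B fall.
  The certificate takes the lower value of each: x and \<open>H\<close> belong to the first sum,
  1/(xq^2) and \<open>F\<close> to the second. Both summands are then reached from it by upward
  shifts.\<close>

lemma quad_term_shift_numer:
  fixes q A E x :: "'a::field"
  defines "F \<equiv> A / x" and "H \<equiv> A * x * q ^ 2"
  defines "G \<equiv> (\<lambda>k. quad_core q A x (1 / (x * q ^ 2)) (A / E) E k / quad_den q F H E k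
    * ((1 - F) * (1 - H) * (1 - (q ^ (2 * k)) ^ 2) * (1 - x ^ 2 * q ^ 2) * (1 - E * q ^ (2 * k))
       / ((1 - x) * (1 - x * q ^ 2))))"
  assumes nz: "q \<noteq> 0" "x \<noteq> 0" "E \<noteq> 0" "x \<noteq> 1" "x * q ^ 2 \<noteq> 1"
    and den: "\<And>k. quad_den q F H E k \<noteq> 0"
  shows "(1 - E / x) * (1 - H) * (\<Sum>k<K. quad_term q A x E k)
    - (1 - E * x * q ^ 2) * (1 - F) * (\<Sum>k<K. quad_term q A (x * q ^ 4) E k) = G K"
proof (induction K)
  case 0
  then show ?case by (simp add: G_def)
next
  case (Suc k)
  define u where "u = q ^ (2 * k)"
  define w where "w = 1 / (x * q ^ 2)"
  define C where "C = quad_core q A x w (A / E) E k / quad_den q F H E k"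
  define f where "f = 1 - F * u ^ 2"
  define h where "h = 1 - H * u ^ 2"
  define cf where "cf = C * ((1 - F) * (1 - H)) / ((1 - x) * (1 - x * q ^ 2) * (f * h) * x)"
  have u3: "q ^ (6 * k) = u ^ 3"
    by (simp add: u_def flip: power_mult)
  have qk: "(q ^ 4) ^ k = u ^ 2" "(q ^ 2) ^ k = u"
    by (simp_all add: u_def flip: power_mult)
  have qu: "q ^ (2 * Suc k) = q ^ 2 * u" by (simp add: u_def flip: power_add)
  have f: "f \<noteq> 0" and h: "h \<noteq> 0" and e: "1 - q ^ 4 * u\<^sup>2 \<noteq> 0" "1 - E * q ^ 2 * u \<noteq> 0"
    using quad_den_SucD[OF den[of "Suc k"]] by (simp_all add: f_def h_def u_def)
  have f0: "1 - F \<noteq> 0" and h0: "1 - H \<noteq> 0"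
    using quad_den_SucD[OF den[of "Suc 0"]] by simp_all
  have x1: "1 - x \<noteq> 0" "1 - x * q ^ 2 \<noteq> 0" using nz by simp_all
  have xf: "x * f = x - A * u ^ 2"
    using nz by (simp add: f_def F_def field_simps)
  have xw: "x * q ^ 2 * (1 - w * u) = x * q ^ 2 - u"
    using nz by (simp add: w_def field_simps)
  have T1: "(1 - E / x) * (1 - H) * quad_term q A x E k
    = cf * ((x-E)*(1-A*u^3)*(x*q^2-u)*(x-u)*h)"
  proof -
    define m where "m = (1 - x) * (1 - x * q ^ 2)"
    have m: "m \<noteq> 0" using x1 by (simp add: m_def)
    have "m * qpoch (w * q ^ 4) (q ^ 2) k = qpoch w (q ^ 2) k * ((x*q^2-u)*(x-u))"
    proof -
      have m': "m = x ^ 2 * q ^ 2 * ((1 - w) * (1 - w * q ^ 2))"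
        using nz by (simp add: w_def m_def field_simps power2_eq_square)
      have "m * qpoch (w * q ^ 4) (q ^ 2) k
          = x ^ 2 * q ^ 2 * ((1 - w) * (1 - w * q ^ 2) * qpoch (w * q ^ 4) (q ^ 2) k)"
        by (subst m') (simp only: mult.assoc)
      also have "(1 - w) * (1 - w * q ^ 2) * qpoch (w * q ^ 4) (q ^ 2) k
          = qpoch w (q ^ 2) k * ((1 - w * u) * (1 - w * q ^ 2 * u))"
        using qpoch_shift2[of w "q ^ 2" k] by (simp add: qk)
      also have "x ^ 2 * q ^ 2 * \<dots>
          = qpoch w (q ^ 2) k * (x ^ 2 * q ^ 2 * ((1 - w * u) * (1 - w * q ^ 2 * u)))"
        by (rule mult.left_commute)
      also have "x ^ 2 * q ^ 2 * ((1 - w * u) * (1 - w * q ^ 2 * u)) = (x*q^2-u)*(x-u)"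
        using nz by (simp add: w_def field_simps power2_eq_square)
      finally show ?thesis .
    qed
    then have "qpoch (w * q ^ 4) (q ^ 2) k = qpoch w (q ^ 2) k * ((x*q^2-u)*(x-u)) / m"
      using m by (simp add: field_simps)
    then have core: "quad_core q A x (w * q ^ 4) (A / E) E k
      = quad_core q A x w (A / E) E k * ((x*q^2-u)*(x-u)) / m"
      by (simp add: quad_core_def)
    have "(1 - F) * qpoch (F * q ^ 4) (q ^ 4) k = qpoch F (q ^ 4) k * f"
      using qpoch_shift[of F "q ^ 4" k] by (simp add: f_def qk)
    then have "qpoch (F * q ^ 4) (q ^ 4) k = qpoch F (q ^ 4) k * f / (1 - F)"
      using f0 by (simp add: field_simps)
    then have den1: "quad_den q (F * q ^ 4) H E k = quad_den q F H E k * f / (1 - F)"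
      by (simp add: quad_den_def)
    have eqs: "q ^ 2 / x = w * q ^ 4" "A * q ^ 4 / x = F * q ^ 4" "1 - E / x = (x - E) / x"
      using nz by (simp_all add: w_def F_def field_simps flip: power_add)
    show ?thesis
      unfolding quad_term_def H_def[symmetric] eqs core den1 u3
      using h f m by (simp add: C_def cf_def m_def mult_ac)
  qed
  have T2: "(1 - E * x * q ^ 2) * (1 - F) * quad_term q A (x * q ^ 4) E k
    = cf * ((1-E*x*q^2)*(1-A*u^3)*(1-x*u)*(1-x*q^2*u)*(x-A*u^2))"
  proof -
    define m where "m = (1 - x) * (1 - x * q ^ 2)"
    have m: "m \<noteq> 0" using x1 by (simp add: m_def)
    have "m * qpoch (x * q ^ 4) (q ^ 2) k = qpoch x (q ^ 2) k * ((1-x*u)*(1-x*q^2*u))"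
      using qpoch_shift2[of x "q ^ 2" k] by (simp add: qk m_def)
    then have "qpoch (x * q ^ 4) (q ^ 2) k = qpoch x (q ^ 2) k * ((1-x*u)*(1-x*q^2*u)) / m"
      using m by (simp add: field_simps)
    then have core: "quad_core q A (x * q ^ 4) w (A / E) E k
      = quad_core q A x w (A / E) E k * ((1-x*u)*(1-x*q^2*u)) / m"
      by (simp add: quad_core_def)
    have "(1 - H) * qpoch (H * q ^ 4) (q ^ 4) k = qpoch H (q ^ 4) k * h"
      using qpoch_shift[of H "q ^ 4" k] by (simp add: h_def qk)
    then have "qpoch (H * q ^ 4) (q ^ 4) k = qpoch H (q ^ 4) k * h / (1 - H)"
      using h0 by (simp add: field_simps)
    then have den1: "quad_den q F (H * q ^ 4) E k = quad_den q F H E k * h / (1 - H)"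
      by (simp add: quad_den_def)
    have eqs: "q ^ 2 / (x * q ^ 4) = w" "A * q ^ 4 / (x * q ^ 4) = F" "A * (x * q ^ 4) * q ^ 2 = H * q ^ 4"
      using nz by (simp_all add: w_def F_def H_def field_simps flip: power_add)
    show ?thesis
      unfolding quad_term_def eqs core den1 u3 xf[symmetric]
      using h f m nz by (simp add: C_def cf_def m_def mult_ac)
  qed
  have G1: "G k = cf * ((1-x^2*q^2) * ((1-u^2)*h*(1-E*u)*(x-A*u^2)))"
    unfolding G_def w_def[symmetric] u_def[symmetric] xf[symmetric]
    using f h nz by (simp add: C_def cf_def mult_ac)
  have G2: "G (Suc k) = cf * ((1-x^2*q^2) * ((1-A*u)*(1-x*u)*(x*q^2-u)*(E-A*u^2)*u))"
  proof -
    define d where "d = (1 - q ^ 4 * u\<^sup>2) * (1 - E * q ^ 2 * u)"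
    have d: "d \<noteq> 0" using e by (simp add: d_def)
    have "1 - (q ^ 2 * u)\<^sup>2 = 1 - q ^ 4 * u\<^sup>2"
      by (simp add: power_mult_distrib flip: power_mult)
    moreover have EA: "E - A * u ^ 2 = E * (1 - A / E * u ^ 2)"
      using nz by (simp add: field_simps)
    ultimately have "G (Suc k) = (quad_core q A x w (A / E) E k * ((1-A*u)*(1-x*u)*(1-w*u)*((E-A*u^2)*q^2*u)))
       / (quad_den q F H E k * (d * (f * h))) * (d * ((1 - F) * (1 - H) * (1-x^2*q^2)) / ((1 - x) * (1 - x * q ^ 2)))"
      unfolding G_def w_def[symmetric] quad_core_Suc quad_den_Suc u_def[symmetric] qu
      by (simp add: d_def f_def h_def mult_ac)
    also have "\<dots> = cf * ((1-x^2*q^2) * ((1-A*u)*(1-x*u)*(x*q^2*(1-w*u))*(E-A*u^2)*u))"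
      using d nz by (simp add: C_def cf_def mult_ac)
    finally show ?thesis unfolding xw .
  qed
  have h': "h = 1 - A*x*q^2*u^2"
    by (simp add: h_def H_def)
  have "(1 - E / x) * (1 - H) * quad_term q A x E k
    - (1 - E * x * q ^ 2) * (1 - F) * quad_term q A (x * q ^ 4) E k = G (Suc k) - G k"
    unfolding T1 T2 G1 G2 right_diff_distrib[symmetric] h'
    unfolding shift_numer_identity ..
  then show ?case
    unfolding sum.lessThan_Suc distrib_left add_diff_add Suc.IH by simp
qed

section \<open>Terminating quadratic summations\<close>

lemma sum_lessThan_eq_first:
  fixes f :: "nat \<Rightarrow> 'a::comm_monoid_add"
  assumes "0 < K" "\<And>k. 0 < k \<Longrightarrow> k < K \<Longrightarrow> f k = 0"
  shows "(\<Sum>k<K. f k) = f 0"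
  by (rule sum.mono_neutral_right[where S = "{0}", THEN trans]) (use assms in auto)

lemma quad_core_eq_0:
  assumes "qpoch A (q ^ 2) k = 0 \<or> qpoch B (q ^ 2) k = 0 \<or> qpoch D (q ^ 4) k = 0"
  shows "quad_core q A B C D E k = 0"
  using assms by (auto simp: quad_core_def)

lemma cancel_common_factors:
  fixes r s t u v :: "'a::field"
  assumes "r \<noteq> 0" "s \<noteq> 0" "t \<noteq> 0" "u \<noteq> 0"
  shows "r * (v * s * t * (- u)) / (r * t * s * u) = - v"
  using assms by simp

lemma ratio_replace:
  fixes p r s t u v w y :: "'a::field"
  assumes "r / s = t / u * v"
  shows "r * w * y / (p * s) = y * (w * t / (u * p) * v)"
proof -
  have "r * w * y / (p * s) = (r / s) * (w * y / p)" by (simp add: mult_ac)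
  also have "\<dots> = y * (w * t / (u * p) * v)" unfolding assms by simp
  finally show ?thesis .
qed

text \<open>Here A/E = q^(-4N), so the terms with k > N vanish. The induction starts from E = A,
  where A/E = 1 leaves only k = 0. Each shift of E by q^4 multiplies the sum by
  \<open>be / al\<close>, whose four factors are the next ones of the four shifted
  factorials.\<close>

lemma sum_quad_term_param:
  fixes q A B :: "'a::field"
  assumes q: "inj (\<lambda>i::nat. q ^ i)" and nz: "q \<noteq> 0" "A \<noteq> 0" "B \<noteq> 0"
    and A: "\<And>j. A * q ^ (j + 2) \<noteq> 1"
    and F: "\<And>k. A * q ^ 4 / B * (q ^ 4) ^ k \<noteq> 1" and H: "\<And>k. A * B * q ^ 2 * (q ^ 4) ^ k \<noteq> 1"
  shows "N < K \<Longrightarrow> (\<Sum>k<K. quad_term q A B (A * q ^ (4 * N)) k)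
    = (1 - A) * ((qpoch (A * q ^ 2) (q ^ 4) N * qpoch (A * q ^ 4) (q ^ 4) N)
      / (qpoch (A * B * q ^ 2) (q ^ 4) N * qpoch (A * q ^ 4 / B) (q ^ 4) N))"
proof (induction N)
  case 0
  have "quad_term q A B A k = 0" if "0 < k" for k
    using nz that by (auto simp: quad_term_def intro!: quad_core_eq_0 qpoch_eq_0[of 0])
  then have "(\<Sum>k<K. quad_term q A B A k) = quad_term q A B A 0"
    using 0 by (intro sum_lessThan_eq_first) auto
  then show ?case
    by (simp add: quad_term_def quad_core_def quad_den_def)
next
  case (Suc N)
  define E where "E = A * q ^ (4 * N)"
  define x where "x = 1 / q ^ (4 * N + 4)"
  define v where "v = (q ^ 4) ^ N"
  define al where "al = (1 - E * B * q ^ 2) * (1 - E * q ^ 4 / B)"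
  define be where "be = (1 - E * q ^ 2) * (1 - E * q ^ 4)"
  have qi: "q ^ i \<noteq> 1" if "i > 0" for i
    using injD[OF q, of i 0] that by auto
  have Ev: "E = A * v" "E * q ^ 4 = A * q ^ (4 * Suc N)"
    by (simp add: E_def v_def power_mult, simp add: E_def power_add mult_ac)
  have den: "quad_den q (A * q ^ 4 / B) (A * B * q ^ 2) E k \<noteq> 0" for k
  proof -
    have "E * q\<^sup>2 * (q\<^sup>2) ^ j \<noteq> 1" for j
      using A[of "4 * N + 2 * j"] unfolding E_def power_add power_mult by (simp only: mult_ac not_False_eq_True)
    moreover have "q ^ 4 * (q ^ 4) ^ j \<noteq> 1" for j
      using qi[of "4 + 4 * j"] by (simp add: power_add flip: power_mult)
    ultimately show ?thesis
      using F H unfolding quad_den_def by (intro no_zero_divisors qpoch_nonzero) auto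
  qed
  \<comment> \<open>The certificate contains this factorial; its vanishing removes the boundary term
    and turns the telescoping relation into a recursion.\<close>
  have "qpoch x (q ^ 4) K = 0"
    using Suc.prems nz by (intro qpoch_eq_0[of "Suc N"]) (auto simp: x_def power_add simp flip: power_mult)
  moreover have "A = x * E * q ^ 4" "E \<noteq> 0" "x \<noteq> 1"
    using nz qi[of "4 * N + 4"] by (simp_all add: x_def E_def power_add)
  ultimately have rec: "al * (\<Sum>k<K. quad_term q A B (E * q ^ 4) k) = be * (\<Sum>k<K. quad_term q A B E k)"
    using quad_term_shift_param[of A x E q B K, OF _ _ _ _ _ den] nz
    by (simp add: quad_core_def al_def be_def)
  have al0: "1 - A * B * q ^ 2 * v \<noteq> 0" "1 - A * q ^ 4 / B * v \<noteq> 0"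
    using F[of N] H[of N] by (auto simp: v_def)
  have "al = (1 - A * B * q ^ 2 * v) * (1 - A * q ^ 4 / B * v)"
       "be = (1 - A * q ^ 2 * v) * (1 - A * q ^ 4 * v)"
    by (simp_all add: al_def be_def Ev(1) mult_ac)
  moreover from this have "(\<Sum>k<K. quad_term q A B (E * q ^ 4) k) = be * (\<Sum>k<K. quad_term q A B E k) / al"
    using rec al0 by (simp add: eq_divide_eq mult_ac)
  ultimately have "(\<Sum>k<K. quad_term q A B (A * q ^ (4 * Suc N)) k)
      = ((1 - A * q ^ 2 * v) * (1 - A * q ^ 4 * v)) * (\<Sum>k<K. quad_term q A B E k)
        / ((1 - A * B * q ^ 2 * v) * (1 - A * q ^ 4 / B * v))"
    unfolding Ev(2) by simp
  also have "(\<Sum>k<K. quad_term q A B E k) = (1 - A) * ((qpoch (A * q ^ 2) (q ^ 4) N * qpoch (A * q ^ 4) (q ^ 4) N)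
      / (qpoch (A * B * q ^ 2) (q ^ 4) N * qpoch (A * q ^ 4 / B) (q ^ 4) N))"
    using Suc by (simp add: E_def)
  finally show ?case
    unfolding qpoch_Suc v_def[symmetric] by (simp only: times_divide_eq_right times_divide_eq_left divide_divide_eq_left mult_ac)
qed

text \<open>The available relation shifts \<open>A\<close> by \<open>q\<^sup>4\<close>, that is \<open>N\<close> by 2, so both parities need a base case.\<close>

lemma sum_quad_term_base_eq_0:
  fixes q B E :: "'a::field"
  assumes q: "inj (\<lambda>i::nat. q ^ i)" and nz: "q \<noteq> 0" "B \<noteq> 0" "E \<noteq> 0"
    and E: "\<And>j. E * q ^ j \<noteq> 1" and B: "\<And>i j. B * q ^ i \<noteq> q ^ j"
  shows "N < K \<Longrightarrow> (\<Sum>k<K. quad_term q (1 / q ^ (2 * N)) B E k) = 0"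
proof (induction N rule: induct_nat_012)
  case 0
  \<comment> \<open>With leading parameter 1, the factor 1 - A q^(6k) kills the term k = 0 and
    (1;q^2)_k all the others.\<close>
  then show ?case
    by (intro sum.neutral) (auto simp: quad_term_def gr0_conv_Suc intro!: quad_core_eq_0 qpoch_eq_0[of 0])
next
  case 1
  have qi: "q ^ i \<noteq> 1" if "i > 0" for i
    using injD[OF q, of i 0] that by auto
  have qp: "q ^ 2 \<noteq> 1" "q ^ 4 \<noteq> 1" "E * q ^ 2 \<noteq> 1" "B \<noteq> 1" "B \<noteq> q ^ 2"
    using qi[of 2] qi[of 4] E[of 2] B[of 0 0] B[of 0 2] by auto
  have "quad_term q (1 / q\<^sup>2) B E k = 0" if "2 \<le> k" for k
  proof -
    have "qpoch (1 / q\<^sup>2) (q\<^sup>2) k = 0"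
      using that nz by (intro qpoch_eq_0[of 1]) auto
    then show ?thesis by (simp add: quad_term_def quad_core_eq_0)
  qed
  \<comment> \<open>With leading parameter q^(-2) only k = 0 and k = 1 survive, and these two terms
    are opposite.\<close>
  then have "(\<Sum>k<K. quad_term q (1 / q\<^sup>2) B E k) = (\<Sum>k<2. quad_term q (1 / q\<^sup>2) B E k)"
    using 1 by (intro sum.mono_neutral_right) auto
  also have "\<dots> = quad_term q (1 / q\<^sup>2) B E 0 + quad_term q (1 / q\<^sup>2) B E 1"
    by (simp add: numeral_2_eq_2)
  also have "quad_term q (1 / q\<^sup>2) B E 0 = 1 - 1 / q\<^sup>2"
    by (simp add: quad_term_def quad_core_def quad_den_def)
  also have "quad_term q (1 / q\<^sup>2) B E 1 = - (1 - 1 / q\<^sup>2)"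
  proof -
    have a: "1 / q ^ 2 * q ^ 6 = q ^ 4" "1 / q\<^sup>2 * q ^ 4 / B = q ^ 2 / B" "1 / q\<^sup>2 * B * q\<^sup>2 = B"
      "q ^ 6 / (q * q) = q ^ 4"
      using nz by (simp_all add: field_simps eval_nat_numeral)
    have "quad_term q (1 / q\<^sup>2) B E 1 = (1 - q ^ 4) * ((1 - 1 / q^2) * (1 - B) * (1 - q^2 / B) * ((1 - 1 / q ^ 2 / E) * q ^ 2 * E))
      / ((1 - q ^ 4) * (1 - q ^ 2 / B) * (1 - B) * (1 - E * q ^ 2))"
      using nz unfolding quad_term_def quad_core_def quad_den_def qpoch_def a
      by (simp add: a power2_eq_square)
    also have "(1 - 1 / q ^ 2 / E) * q ^ 2 * E = - (1 - E * q ^ 2)"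
      using nz by (simp add: field_simps)
    finally have "quad_term q (1 / q\<^sup>2) B E 1 = (1 - q ^ 4) * ((1 - 1 / q^2) * (1 - B) * (1 - q^2 / B) * - (1 - E * q ^ 2))
      / ((1 - q ^ 4) * (1 - q ^ 2 / B) * (1 - B) * (1 - E * q ^ 2))" .
    also have "\<dots> = - (1 - 1 / q\<^sup>2)"
      by (rule cancel_common_factors) (use qp nz in auto)
    finally show ?thesis .
  qed
  finally show ?case by simp
next
  case (ge2 N)
  define x where "x = 1 / q ^ (2 * Suc (Suc N))"
  have xq: "x * q ^ 4 = 1 / q ^ (2 * N)"
    using nz by (simp add: x_def field_simps power_add eval_nat_numeral)
  have qi: "q ^ i \<noteq> 1" if "i > 0" for i
    using injD[OF q, of i 0] that by auto
  define F where "F = x * q ^ 4 / B"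
  define H where "H = x * B * q ^ 2"
  have den: "quad_den q F H E k \<noteq> 0" for k
  proof -
    have "E * q\<^sup>2 * (q\<^sup>2) ^ j \<noteq> 1" for j
      using E[of "2 + 2 * j"] unfolding power_add power_mult by (simp only: mult_ac not_False_eq_True)
    moreover have "q ^ 4 * (q ^ 4) ^ j \<noteq> 1" for j
      using qi[of "4 + 4 * j"] by (simp add: power_add flip: power_mult)
    moreover have "F * (q ^ 4) ^ j \<noteq> 1" for j
      using B[of "2 * N" "4 * j"] nz unfolding F_def xq by (auto simp: field_simps simp flip: power_mult)
    moreover have "H * (q ^ 4) ^ j \<noteq> 1" for j
    proof -
      have "H * (q ^ 4) ^ j = B * q ^ (2 + 4 * j) / q ^ (2 * Suc (Suc N))"
        unfolding H_def x_def power_add power_mult[of q 4] by simp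
      then show ?thesis
        using B[of "2 + 4 * j" "2 * Suc (Suc N)"] nz by (simp only: divide_eq_1_iff) blast
    qed
    ultimately show ?thesis
      unfolding quad_den_def by (intro no_zero_divisors qpoch_nonzero) auto
  qed
  have "qpoch x (q ^ 2) K = 0"
  proof (rule qpoch_eq_0)
    show "x * (q ^ 2) ^ Suc (Suc N) = 1"
      unfolding x_def power_mult[symmetric] times_divide_eq_left mult_1
      by (rule divide_self) (use nz in simp)
  qed (use ge2.prems in simp)
  moreover have "x / E \<noteq> 1"
    using E[of "2 * Suc (Suc N)"] nz unfolding x_def by (auto simp: divide_simps mult_ac)
  moreover have "F \<noteq> 1" "H \<noteq> 1"
    using quad_den_SucD[OF den[of "Suc 0"]] by simp_all
  \<comment> \<open>The relation now reads (1 - F)(1 - H) times the sum at x equals 0, and neither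
    factor vanishes.\<close>
  moreover have "(\<Sum>k<K. quad_term q (x * q ^ 4) B E k) = 0"
    unfolding xq using ge2 by simp
  ultimately have "(\<Sum>k<K. quad_term q x B E k) = 0"
    using quad_term_shift_base[of x "x / E" E q B K] den nz
    by (simp add: quad_core_eq_0 F_def H_def)
  then show ?case by (simp add: x_def)
qed

text \<open>The step from \<open>m = 0\<close> to \<open>m = 1\<close> hits the pole \<open>x * q\<^sup>2 = 1\<close> of the certificate, hence the
  induction starts at \<open>m = 1\<close>.\<close>

lemma sum_quad_term_numer:
  fixes q E :: "'a::field"
  assumes q: "inj (\<lambda>i::nat. q ^ i)" and nz: "q \<noteq> 0" "E \<noteq> 0"
    and E: "\<And>j. E * q ^ j \<noteq> 1"
  shows "0 < m \<Longrightarrow> 2 * m \<le> K \<Longrightarrow> (\<Sum>k<K. quad_term q q (q ^ 2 / q ^ (4 * m)) E k)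
    = (1 - q) * ((qpoch (q ^ 3) (q ^ 4) m * qpoch (1 / E) (q ^ 4) m)
      / (qpoch (1 / q) (q ^ 4) m * qpoch (E * q ^ 2) (q ^ 4) m) * (E / q) ^ m)"
proof (induction m rule: nat_induct_non_zero)
  case 1
  have qi: "q ^ i \<noteq> 1" if "i > 0" for i
    using injD[OF q, of i 0] that by auto
  have qp: "q \<noteq> 1" "q ^ 4 \<noteq> 1" "q ^ 7 \<noteq> 1" "E * q ^ 2 \<noteq> 1"
    using qi[of 1] qi[of 4] qi[of 7] E[of 2] by auto
  have B: "q ^ 2 / q ^ (4 * 1) = 1 / q ^ 2"
    using nz by (simp add: field_simps flip: power_add)
  have "quad_term q q (1 / q\<^sup>2) E k = 0" if "2 \<le> k" for k
  proof -
    have "qpoch (1 / q\<^sup>2) (q\<^sup>2) k = 0"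
      using that nz by (intro qpoch_eq_0[of 1]) auto
    then show ?thesis by (simp add: quad_term_def quad_core_eq_0)
  qed
  then have "(\<Sum>k<K. quad_term q q (1 / q\<^sup>2) E k) = (\<Sum>k<2. quad_term q q (1 / q\<^sup>2) E k)"
    using 1 by (intro sum.mono_neutral_right) auto
  also have "\<dots> = quad_term q q (1 / q\<^sup>2) E 0 + quad_term q q (1 / q\<^sup>2) E 1"
    by (simp add: numeral_2_eq_2)
  also have "quad_term q q (1 / q\<^sup>2) E 0 = 1 - q"
    by (simp add: quad_term_def quad_core_def quad_den_def)
  also have "quad_term q q (1 / q\<^sup>2) E 1 = - ((1 - q ^ 2) * (E - q) / (1 - E * q ^ 2))"
  proof -
    have a: "q ^ 2 / (1 / q ^ 2) = q ^ 4" "q * q ^ 4 / (1 / q ^ 2) = q ^ 7" "q * (1 / q\<^sup>2) * q\<^sup>2 = q" "q * q ^ 6 = q ^ 7"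
      using nz by (simp_all add: field_simps eval_nat_numeral)
    have "quad_term q q (1 / q\<^sup>2) E 1 = (1 - q ^ 7) * ((1 - q) * (1 - 1 / q^2) * (1 - q^4) * (1 - q / E) * q ^ 2 * E)
      / ((1 - q ^ 4) * (1 - q ^ 7) * (1 - q) * (1 - E * q ^ 2))"
      unfolding quad_term_def quad_core_def quad_den_def qpoch_def a by (simp add: a power2_eq_square)
    also have "(1 - q) * (1 - 1 / q^2) * (1 - q^4) * (1 - q / E) * q ^ 2 * E
       = (1 - q) * (1 - q^4) * (((1 - 1 / q^2) * q ^ 2) * ((1 - q / E) * E))"
      by (simp only: mult_ac)
    also have "(1 - 1 / q^2) * q ^ 2 = - (1 - q ^ 2)"
      using nz by (simp add: left_diff_distrib)
    also have "(1 - q / E) * E = E - q"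
      using nz by (simp add: left_diff_distrib)
    finally have "quad_term q q (1 / q\<^sup>2) E 1 = (q ^ 2 - 1) * (E - q) / (1 - E * q ^ 2)"
      using qp by simp
    also have "(q ^ 2 - 1) * (E - q) = - ((1 - q ^ 2) * (E - q))"
      by (simp add: algebra_simps)
    finally show ?thesis by simp
  qed
  finally have "(\<Sum>k<K. quad_term q q (1 / q\<^sup>2) E k)
      = ((1 - q) * (1 - E * q ^ 2) - (1 - q ^ 2) * (E - q)) / (1 - E * q ^ 2)"
    using qp by (simp add: diff_divide_distrib)
  \<comment> \<open>The two surviving terms combine into a product, which is what makes a closed
    form possible at m = 1.\<close>
  also have "(1 - q) * (1 - E * q ^ 2) - (1 - q ^ 2) * (E - q) = (1 - q ^ 3) * (1 - E)"
    by algebra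
  also have "(1 - q ^ 3) * (1 - E) / (1 - E * q ^ 2)
      = (1 - q) * ((1 - q ^ 3) * (1 - 1 / E) / ((1 - 1 / q) * (1 - E * q ^ 2)) * (E / q))"
  proof -
    have "(1 - 1 / E) * E = - (1 - E)" "(1 - 1 / q) * q = - (1 - q)"
      using nz by (simp_all add: left_diff_distrib)
    moreover have "(1 - q ^ 3) * (1 - 1 / E) / ((1 - 1 / q) * (1 - E * q ^ 2)) * (E / q)
      = (1 - q ^ 3) * ((1 - 1 / E) * E) / (((1 - 1 / q) * q) * (1 - E * q ^ 2))"
      by (simp only: times_divide_times_eq mult_ac)
    moreover have "s * t / u = r * (s * (- t) / (- r * u))" if "r \<noteq> 0" for r s t u :: 'a
      using that by simp
    ultimately show ?thesis
      using qp by (metis right_minus_eq)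
  qed
  finally show ?case
    unfolding B by (simp add: qpoch_def)
next
  case (Suc m)
  define x where "x = q ^ 2 / q ^ (4 * Suc m)"
  define v where "v = (q ^ 4) ^ m"
  have v: "v \<noteq> 0" "v = q ^ (4 * m)" using nz by (simp_all add: v_def power_mult)
  have xv: "x = 1 / (q ^ 2 * v)"
    using nz by (simp add: x_def v field_simps power_add eval_nat_numeral)
  have xq: "x * q ^ 4 = q ^ 2 / q ^ (4 * m)"
    using nz by (simp add: x_def field_simps power_add eval_nat_numeral)
  have qq: "q ^ i \<noteq> q ^ j" if "i \<noteq> j" for i j
    using injD[OF q, of i j] that by auto
  have qi: "q ^ i \<noteq> 1" if "i > 0" for i
    using qq[of i 0] that by auto
  define F where "F = q / x"
  define H where "H = q * x * q ^ 2"
  have F: "F = q ^ 3 * v" and H: "H = q / v"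
    using nz v by (simp_all add: F_def H_def xv field_simps eval_nat_numeral)
  have den: "quad_den q F H E k \<noteq> 0" for k
  proof -
    have "E * q\<^sup>2 * (q\<^sup>2) ^ j \<noteq> 1" for j
      using E[of "2 + 2 * j"] unfolding power_add power_mult by (simp only: mult_ac not_False_eq_True)
    moreover have "q ^ 4 * (q ^ 4) ^ j \<noteq> 1" for j
      using qi[of "4 + 4 * j"] by (simp add: power_add flip: power_mult)
    moreover have "F * (q ^ 4) ^ j \<noteq> 1" for j
      using qi[of "3 + 4 * m + 4 * j"] unfolding F v(2) by (simp add: power_add flip: power_mult)
    moreover have "H * (q ^ 4) ^ j \<noteq> 1" for j
    proof -
      \<comment> \<open>\<open>H * (q ^ 4) ^ j\<close> is q to the exponent 1 + 4j - 4m, which is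
        never zero modulo 4.\<close>
      have "1 + 4 * j \<noteq> 4 * m" by presburger
      from qq[OF this] show ?thesis
        using nz unfolding H v(2) by (simp add: divide_simps flip: power_mult)
    qed
    ultimately show ?thesis
      unfolding quad_den_def by (intro no_zero_divisors qpoch_nonzero) auto
  qed
  have "qpoch x (q ^ 2) K = 0"
  proof (rule qpoch_eq_0[of "2 * m + 1"])
    show "2 * m + 1 < K" using Suc.prems by simp
    show "x * (q ^ 2) ^ (2 * m + 1) = 1"
      using nz by (simp add: xv v(2) power_add power_mult mult_ac flip: power_mult)
  qed
  moreover have "x \<noteq> 1"
    using qi[of "2 + 4 * m"] unfolding xv v(2) power_add by simp
  moreover have "x * q ^ 2 \<noteq> 1" "x \<noteq> 0"
    using qi[of "4 * m"] Suc.hyps nz unfolding xv v(2) by (simp_all add: field_simps)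
  moreover have F1: "F \<noteq> 1" and H1: "H \<noteq> 1"
    using quad_den_SucD[OF den[of "Suc 0"]] by simp_all
  moreover have "E / x = E * q ^ 2 * v" "E * x * q ^ 2 = E / v"
    using nz v by (simp_all add: xv field_simps)
  ultimately have "(1 - E * q ^ 2 * v) * (1 - q / v) * (\<Sum>k<K. quad_term q q x E k)
      = (1 - E / v) * (1 - q ^ 3 * v) * (\<Sum>k<K. quad_term q q (x * q ^ 4) E k)"
    using quad_term_shift_numer[of q x E q K] den nz
    by (simp add: quad_core_eq_0 F_def[symmetric] H_def[symmetric]) (simp add: F H)
  moreover have E2: "1 - E * q ^ 2 * v \<noteq> 0"
    using E[of "2 + 4 * m"] unfolding v(2) power_add by (simp add: mult.assoc)
  moreover have H2: "1 - q / v \<noteq> 0" "v - q \<noteq> 0" "q - v \<noteq> 0"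
    using H1 v(1) unfolding H by auto
  ultimately have "(\<Sum>k<K. quad_term q q x E k)
      = (1 - E / v) * (1 - q ^ 3 * v) * (\<Sum>k<K. quad_term q q (x * q ^ 4) E k)
       / ((1 - E * q ^ 2 * v) * (1 - q / v))"
    by (simp add: eq_divide_eq mult_ac)
  also have "\<dots> = (\<Sum>k<K. quad_term q q (x * q ^ 4) E k) *
       ((1 - q ^ 3 * v) * (1 - 1 / E * v) / ((1 - 1 / q * v) * (1 - E * q ^ 2 * v)) * (E / q))"
  proof -
    \<comment> \<open>The recursion produces factors in 1/v = q^(-4m). Reversing them gives the next
      factors of (1/E;q^4) and (1/q;q^4) and leaves one E/q per step; this is the origin of the
      power \<open>(E / q) ^ m\<close>.\<close>
    have "(1 - E / v) / (1 - q / v) = (1 - 1 / E * v) / (1 - 1 / q * v) * (E / q)"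
      using nz v(1) H2 by (simp add: divide_simps) algebra
    then show ?thesis
      by (rule ratio_replace)
  qed
  also have "(\<Sum>k<K. quad_term q q (x * q ^ 4) E k) = (1 - q) * ((qpoch (q ^ 3) (q ^ 4) m * qpoch (1 / E) (q ^ 4) m)
      / (qpoch (1 / q) (q ^ 4) m * qpoch (E * q ^ 2) (q ^ 4) m) * (E / q) ^ m)"
    unfolding xq using Suc.IH Suc.prems by simp
  finally show ?case
    unfolding qpoch_Suc v_def[symmetric] x_def[symmetric] power_Suc
    by (simp only: times_divide_eq_right times_divide_eq_left divide_divide_eq_left mult_ac)
qed

section \<open>Congruences in the localization at a prime\<close>

text \<open>The relation includes \<open>p\<close>-integrality of both sides, which makes it compatible with the ring
  operations without side conditions; \<open>fract_cong p x x\<close> says that \<open>x\<close> is \<open>p\<close>-integral.\<close>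

definition fract_cong :: "'a::idom \<Rightarrow> 'a fract \<Rightarrow> 'a fract \<Rightarrow> bool" where
  "fract_cong p x y \<longleftrightarrow> (\<exists>M N D. \<not> p dvd D \<and> p dvd M - N \<and> x = Fract M D \<and> y = Fract N D)"

definition fract_unit :: "'a::idom \<Rightarrow> 'a fract \<Rightarrow> bool" where
  "fract_unit p x \<longleftrightarrow> (\<exists>N D. \<not> p dvd N \<and> \<not> p dvd D \<and> x = Fract N D)"

lemma fract_cong_sym: "fract_cong p x y \<Longrightarrow> fract_cong p y x"
  unfolding fract_cong_def by (metis dvd_minus_iff minus_diff_eq)

lemma Fract_extend: "\<not> p dvd (d::'a::idom) \<Longrightarrow> Fract M D = Fract (M * d) (D * d)"
  by (metis dvd_0_right mult.commute mult_fract_cancel)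

lemma not_prime_dvd_mult: "prime_elem p \<Longrightarrow> \<not> p dvd a \<Longrightarrow> \<not> p dvd b \<Longrightarrow> \<not> p dvd a * (b::'a::idom)"
  by (simp add: prime_elem_dvd_mult_iff)

text \<open>The product of the two denominators serves all four fractions, and primality keeps p
  from dividing it. Compatibility with the field operations thereby reduces to computations with
  numerators.\<close>

lemma fract_cong_2E:
  assumes p: "prime_elem p" and "fract_cong p w x" "fract_cong p y z"
  obtains K L M N D where "\<not> p dvd D" "D \<noteq> 0" "p dvd K - L" "p dvd M - N"
    "w = Fract K D" "x = Fract L D" "y = Fract M D" "z = Fract N D"
proof -
  obtain K L D1 where 1: "\<not> p dvd D1" "p dvd K - L" "w = Fract K D1" "x = Fract L D1"
    using assms(2) by (auto simp: fract_cong_def)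
  obtain M N D2 where 2: "\<not> p dvd D2" "p dvd M - N" "y = Fract M D2" "z = Fract N D2"
    using assms(3) by (auto simp: fract_cong_def)
  show ?thesis
  proof (rule that)
    show "\<not> p dvd D1 * D2" using not_prime_dvd_mult p 1 2 by blast
    then show "D1 * D2 \<noteq> 0" by auto
    show "p dvd K * D2 - L * D2" "p dvd M * D1 - N * D1"
      using 1 2 by (simp_all flip: left_diff_distrib)
    show "w = Fract (K * D2) (D1 * D2)" "x = Fract (L * D2) (D1 * D2)"
      using 1 2 Fract_extend by blast+
    show "y = Fract (M * D1) (D1 * D2)" "z = Fract (N * D1) (D1 * D2)"
      using 1 2 Fract_extend[of p D1] by (metis mult.commute)+
  qed
qed

context
  fixes p :: "'a::idom"
  assumes p: "prime_elem p"
begin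

lemma fract_cong_dvd: "p dvd f - g \<Longrightarrow> fract_cong p (to_fract f) (to_fract g)"
  using p unfolding fract_cong_def to_fract_def prime_elem_def by blast

lemma fract_cong_to_fract: "fract_cong p (to_fract f) (to_fract f)"
  by (rule fract_cong_dvd) simp

lemma fract_cong_0: "fract_cong p 0 0" and fract_cong_1: "fract_cong p 1 1"
  using fract_cong_to_fract[of 0] fract_cong_to_fract[of 1] by simp_all

lemma fract_cong_add:
  assumes "fract_cong p w x" "fract_cong p y z"
  shows "fract_cong p (w + y) (x + z)"
  using p assms
proof (rule fract_cong_2E)
  fix K L M N D
  assume D: "\<not> p dvd D" "D \<noteq> 0" "p dvd K - L" "p dvd M - N"
    and e: "w = Fract K D" "x = Fract L D" "y = Fract M D" "z = Fract N D"
  have "w + y = Fract (K + M) D" "x + z = Fract (L + N) D"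
    using D(2) by (simp_all add: e eq_fract algebra_simps)
  moreover have "p dvd (K + M) - (L + N)"
    using dvd_add[OF D(3,4)] by (simp add: algebra_simps)
  ultimately show ?thesis
    using D unfolding fract_cong_def by blast
qed

lemma fract_cong_mult:
  assumes "fract_cong p w x" "fract_cong p y z"
  shows "fract_cong p (w * y) (x * z)"
  using p assms
proof (rule fract_cong_2E)
  fix K L M N D
  assume D: "\<not> p dvd D" "D \<noteq> 0" "p dvd K - L" "p dvd M - N"
    and e: "w = Fract K D" "x = Fract L D" "y = Fract M D" "z = Fract N D"
  have "K * M - L * N = (K - L) * M + L * (M - N)"
    by (simp add: algebra_simps)
  then have "p dvd K * M - L * N"
    using D(3,4) by simp
  moreover have "\<not> p dvd D * D"
    using D(1) p not_prime_dvd_mult by blast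
  ultimately show ?thesis
    unfolding fract_cong_def e mult_fract by blast
qed

lemma fract_cong_minus: "fract_cong p x y \<Longrightarrow> fract_cong p (- x) (- y)"
  using fract_cong_mult[OF fract_cong_to_fract[of "- 1"]] by simp

lemma fract_cong_diff:
  "fract_cong p w x \<Longrightarrow> fract_cong p y z \<Longrightarrow> fract_cong p (w - y) (x - z)"
  using fract_cong_add[OF _ fract_cong_minus, of w x y z] by simp

lemma fract_cong_trans:
  assumes "fract_cong p x y" "fract_cong p y z"
  shows "fract_cong p x z"
  using p assms
proof (rule fract_cong_2E)
  fix K L M N D
  assume D: "\<not> p dvd D" "D \<noteq> 0" "p dvd K - L" "p dvd M - N"
    and e: "x = Fract K D" "y = Fract L D" "y = Fract M D" "z = Fract N D"
  have "L = M"
    using D(2) e(2,3) by (simp add: eq_fract)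
  with D have "p dvd K - N"
    using dvd_add[OF D(3,4)] by simp
  with D e show ?thesis
    unfolding fract_cong_def by blast
qed

lemma fract_cong_power: "fract_cong p x y \<Longrightarrow> fract_cong p (x ^ n) (y ^ n)"
  by (induction n) (auto intro: fract_cong_1 fract_cong_mult)

lemma fract_cong_prod:
  "(\<And>i. i \<in> A \<Longrightarrow> fract_cong p (f i) (g i)) \<Longrightarrow> fract_cong p (\<Prod>i\<in>A. f i) (\<Prod>i\<in>A. g i)"
  by (induction A rule: infinite_finite_induct) (auto intro: fract_cong_1 fract_cong_mult)

lemma fract_cong_sum:
  "(\<And>i. i \<in> A \<Longrightarrow> fract_cong p (f i) (g i)) \<Longrightarrow> fract_cong p (\<Sum>i\<in>A. f i) (\<Sum>i\<in>A. g i)"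
  by (induction A rule: infinite_finite_induct) (auto intro: fract_cong_0 fract_cong_add)

lemma fract_unit_imp_cong: "fract_unit p x \<Longrightarrow> fract_cong p x x"
  unfolding fract_unit_def fract_cong_def by (metis diff_self dvd_0_right)

lemma fract_unit_to_fract: "\<not> p dvd f \<Longrightarrow> fract_unit p (to_fract f)"
  using p unfolding fract_unit_def to_fract_def prime_elem_def by blast

lemma fract_unit_1: "fract_unit p 1"
  using fract_unit_to_fract[of 1] p by (auto simp: prime_elem_def)

lemma fract_unit_mult:
  assumes "fract_unit p x" "fract_unit p y"
  shows "fract_unit p (x * y)"
proof -
  obtain M D N E where "\<not> p dvd M" "\<not> p dvd D" "x = Fract M D" "\<not> p dvd N" "\<not> p dvd E" "y = Fract N E"
    using assms unfolding fract_unit_def by blast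
  then have "\<not> p dvd M * N" "\<not> p dvd D * E" "x * y = Fract (M * N) (D * E)"
    using p not_prime_dvd_mult by simp_all
  then show ?thesis unfolding fract_unit_def by blast
qed

lemma fract_unit_inverse:
  assumes "fract_unit p x" shows "fract_unit p (inverse x)"
proof -
  obtain N D where "\<not> p dvd N" "\<not> p dvd D" "x = Fract N D"
    using assms unfolding fract_unit_def by blast
  then have "\<not> p dvd D" "\<not> p dvd N" "inverse x = Fract D N" by simp_all
  then show ?thesis unfolding fract_unit_def by blast
qed

lemma fract_unit_minus:
  assumes "fract_unit p x" shows "fract_unit p (- x)"
proof -
  obtain N D where "\<not> p dvd N" "\<not> p dvd D" "x = Fract N D"
    using assms unfolding fract_unit_def by blast
  then have "\<not> p dvd - N" "\<not> p dvd D" "- x = Fract (- N) D" by simp_all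
  then show ?thesis unfolding fract_unit_def by blast
qed

lemma fract_unit_divide: "fract_unit p x \<Longrightarrow> fract_unit p y \<Longrightarrow> fract_unit p (x / y)"
  by (simp add: divide_inverse fract_unit_mult fract_unit_inverse)

lemma fract_unit_power: "fract_unit p x \<Longrightarrow> fract_unit p (x ^ n)"
  by (induction n) (auto intro: fract_unit_1 fract_unit_mult)

lemma fract_unit_prod: "(\<And>i. i \<in> A \<Longrightarrow> fract_unit p (f i)) \<Longrightarrow> fract_unit p (\<Prod>i\<in>A. f i)"
  by (induction A rule: infinite_finite_induct) (auto intro: fract_unit_1 fract_unit_mult)

lemma fract_unit_nonzero: "fract_unit p x \<Longrightarrow> x \<noteq> 0"
  unfolding fract_unit_def Fract_conv_to_fract by auto

lemma fract_unit_cong: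
  assumes "fract_cong p x y" "fract_unit p x"
  shows "fract_unit p y"
proof -
  obtain M N D where 1: "\<not> p dvd D" "p dvd M - N" "x = Fract M D" "y = Fract N D"
    using assms(1) by (auto simp: fract_cong_def)
  obtain N' D' where 2: "\<not> p dvd N'" "\<not> p dvd D'" "x = Fract N' D'"
    using assms(2) by (auto simp: fract_unit_def)
  have "D \<noteq> 0" "D' \<noteq> 0" using 1 2 by auto
  then have "M * D' = N' * D"
    using 1 2 by (simp add: eq_fract)
  then have "\<not> p dvd M"
    using 1 2 p by (metis dvd_mult2 not_prime_dvd_mult)
  then have "\<not> p dvd N"
    using 1(2) by (metis dvd_add_right_iff diff_add_cancel)
  with 1 show ?thesis by (auto simp: fract_unit_def)
qed

text \<open>Both inverses are integral because y is a unit along with x; multiplying the congruence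
  by their product exchanges the roles of x and y.\<close>

lemma fract_cong_inverse:
  assumes "fract_cong p x y" "fract_unit p x"
  shows "fract_cong p (inverse x) (inverse y)"
proof -
  have y: "fract_unit p y" using assms fract_unit_cong by blast
  note u = fract_unit_imp_cong[OF fract_unit_inverse[OF assms(2)]]
    fract_unit_imp_cong[OF fract_unit_inverse[OF y]]
  have "fract_cong p (inverse x * inverse y * y) (inverse x * inverse y * x)"
    by (intro fract_cong_mult u fract_cong_sym[OF assms(1)])
  moreover have "inverse x * inverse y * y = inverse x" "inverse x * inverse y * x = inverse y"
    using fract_unit_nonzero[OF assms(2)] fract_unit_nonzero[OF y] by simp_all
  ultimately show ?thesis by simp
qed

lemma fract_cong_divide:
  "fract_cong p w x \<Longrightarrow> fract_cong p y z \<Longrightarrow> fract_unit p y \<Longrightarrow> fract_cong p (w / y) (x / z)"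
  by (simp add: divide_inverse fract_cong_mult fract_cong_inverse)

lemma fract_cong_0_mult: "fract_cong p x 0 \<Longrightarrow> fract_cong p y y \<Longrightarrow> fract_cong p (x * y) 0"
  using fract_cong_mult[of x 0 y y] by simp

end

section \<open>From local congruences to a congruence modulo a squarefree polynomial\<close>

lemma squarefree_dvdI:
  fixes x y :: "'a::factorial_semiring"
  assumes "squarefree x" "\<And>p. prime p \<Longrightarrow> p dvd x \<Longrightarrow> p dvd y"
  shows "x dvd y"
proof (cases "y = 0")
  case False
  have x: "x \<noteq> 0" using assms(1) by auto
  show ?thesis
  proof (rule multiplicity_le_imp_dvd[OF x])
    fix p :: 'a assume p: "prime p"
    show "multiplicity p x \<le> multiplicity p y"
    proof (cases "p dvd x")
      case True
      then have "multiplicity p y \<ge> 1"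
        using assms(2) p False by (intro multiplicity_geI) auto
      moreover have "multiplicity p x \<le> 1"
        using squarefree_factorial_semiring''[OF x] assms(1) p by blast
      ultimately show ?thesis by simp
    qed (simp add: not_dvd_imp_multiplicity_0)
  qed
qed simp

lemma reduced_fract_exists:
  fixes x :: "qab_ratfun"
  obtains N D where "D \<noteq> 0" "coprime N D" "x = Fract N D"
proof (rule that)
  have "quot_of_fract x \<in> normalized_fracts" by simp
  then show "coprime (fst (quot_of_fract x)) (snd (quot_of_fract x))" "snd (quot_of_fract x) \<noteq> 0"
    by (auto simp: normalized_fracts_def)
  show "x = Fract (fst (quot_of_fract x)) (snd (quot_of_fract x))"
    by simp
qed

lemma coprime_prime_factorI:
  fixes x y :: "'a::factorial_semiring"
  assumes "y \<noteq> 0" "\<And>p. prime p \<Longrightarrow> p dvd x \<Longrightarrow> p dvd y \<Longrightarrow> False"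
  shows "coprime x y"
proof (rule coprimeI)
  fix c assume c: "c dvd x" "c dvd y"
  then have "c \<noteq> 0" using assms(1) by auto
  then show "is_unit c"
    using c assms(2) by (meson dvd_trans prime_divisor_exists)
qed

text \<open>An integral fraction has some denominator D' prime to p. Cross-multiplying with the
  reduced form gives N D' = M D, so if p divided D it would divide N too.\<close>

lemma reduced_denom_not_dvd:
  fixes p :: "'a::{algebraic_semidom,idom}"
  assumes p: "prime_elem p" and "coprime N D" "D \<noteq> 0" "fract_cong p (Fract N D) y"
  shows "\<not> p dvd D"
proof
  assume d: "p dvd D"
  obtain M D' where D': "\<not> p dvd D'" "Fract N D = Fract M D'"
    using assms(4) by (auto simp: fract_cong_def)
  then have "D' \<noteq> 0" by auto
  with D' have "N * D' = M * D"
    using assms(3) by (simp add: eq_fract)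
  then have "p dvd N * D'" using d by simp
  then have "p dvd N" using p D'(1) by (simp add: prime_elem_dvd_mult_iff)
  with d have "is_unit p" using assms(2) coprime_common_divisor by blast
  with p show False by (auto simp: prime_elem_def)
qed

lemma coprime_denomI:
  assumes "P \<noteq> 0" "\<And>p. prime p \<Longrightarrow> p dvd P \<Longrightarrow> fract_cong p x x"
  shows "coprime_denom P x"
proof -
  obtain N D where ND: "D \<noteq> 0" "coprime N D" "x = Fract N D"
    by (rule reduced_fract_exists)
  have "coprime D P"
  proof (rule coprime_prime_factorI)
    show False if "prime p" "p dvd D" "p dvd P" for p
      using reduced_denom_not_dvd[OF prime_imp_prime_elem[OF that(1)] ND(2,1)] assms(2)[OF that(1,3)] ND(3) that(2)
      by simp
  qed (rule assms(1))
  with ND show ?thesis by (auto simp: coprime_denom_def)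
qed

text \<open>The local congruences may use a different denominator for each p. The reduced form of x
  - y serves all of them at once: no prime of P divides its denominator, each divides its numerator,
  and squarefreeness combines these divisibilities.\<close>

lemma ratfun_congI:
  assumes P: "squarefree P" and cong: "\<And>p. prime p \<Longrightarrow> p dvd P \<Longrightarrow> fract_cong p x y"
  shows "ratfun_cong x y P"
proof -
  have P0: "P \<noteq> 0" using P by auto
  have refl: "fract_cong p x x" "fract_cong p y y" if "prime p" "p dvd P" for p
    using fract_cong_trans[OF prime_imp_prime_elem[OF that(1)] cong[OF that] fract_cong_sym[OF cong[OF that]]]
      fract_cong_trans[OF prime_imp_prime_elem[OF that(1)] fract_cong_sym[OF cong[OF that]] cong[OF that]]
    by simp_all
  have diff: "fract_cong p (x - y) 0" if "prime p" "p dvd P" for p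
    using fract_cong_diff[OF prime_imp_prime_elem[OF that(1)] cong[OF that] refl(2)[OF that]] by simp
  obtain N D where ND: "D \<noteq> 0" "coprime N D" "x - y = Fract N D"
    by (rule reduced_fract_exists)
  have nd: "\<not> p dvd D" if "prime p" "p dvd P" for p
    using reduced_denom_not_dvd[OF prime_imp_prime_elem[OF that(1)] ND(2,1)] diff[OF that] ND(3) by simp
  have "P dvd N"
  proof (rule squarefree_dvdI[OF P])
    fix p assume pp: "prime p" "p dvd P"
    obtain M M' D' where D': "\<not> p dvd D'" "p dvd M - M'" "x - y = Fract M D'" "0 = Fract M' D'"
      using diff[OF pp] by (auto simp: fract_cong_def)
    have "D' \<noteq> 0" using D' by auto
    then have "M' = 0" "N * D' = M * D"
      using D' ND by (simp_all add: eq_fract Zero_fract_def)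
    then have "p dvd N * D'" using D' by simp
    then show "p dvd N" using pp D' by (simp add: prime_dvd_mult_iff)
  qed
  moreover have "coprime D P"
    using P0 nd by (intro coprime_prime_factorI) auto
  ultimately show ?thesis
    unfolding ratfun_cong_def using coprime_denomI[OF P0 refl(1)] coprime_denomI[OF P0 refl(2)] ND by blast
qed

section \<open>The primes dividing the modulus\<close>

lemma to_fract_power: "to_fract (x ^ n) = to_fract x ^ n"
  by (induction n) simp_all

text \<open>Specialization of q, a, b to rational numbers. A point where r vanishes and f does not
  is a witness that r does not divide f.\<close>

definition eval_qab :: "rat \<Rightarrow> rat \<Rightarrow> rat \<Rightarrow> qab_poly \<Rightarrow> rat" where
  "eval_qab x y z f = poly (poly (poly f [:[:z:]:]) [:y:]) x"

lemma eval_qab_simps [simp]: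
  "eval_qab x y z (f + g) = eval_qab x y z f + eval_qab x y z g"
  "eval_qab x y z (f - g) = eval_qab x y z f - eval_qab x y z g"
  "eval_qab x y z (f * g) = eval_qab x y z f * eval_qab x y z g"
  "eval_qab x y z (f ^ k) = eval_qab x y z f ^ k"
  "eval_qab x y z 1 = 1" "eval_qab x y z 0 = 0"
  "eval_qab x y z q_poly = x" "eval_qab x y z a_poly = y" "eval_qab x y z b_poly = z"
  by (simp_all add: eval_qab_def q_poly_def a_poly_def b_poly_def)

lemma not_dvd_of_eval_qab:
  assumes "eval_qab x y z r = 0" "eval_qab x y z f \<noteq> 0"
  shows "\<not> r dvd f"
  using assms by (auto simp: dvd_def)

lemma q_poly_power: "q_poly ^ n = [:[:[:0, 1:] ^ n:]:]"
  by (simp add: q_poly_def poly_const_pow)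

text \<open>The first two factors are linear in a over polynomials in q, the third is linear in b;
  in each case the two coefficients are coprime. Primality persists when further variables are
  adjoined.\<close>

lemma prime_elem_modulus_factors:
  "prime_elem (1 - a_poly * q_poly ^ n)" "prime_elem (a_poly - q_poly ^ n)" "prime_elem (b_poly - q_poly ^ n)"
proof -
  have "1 - a_poly * q_poly ^ n = [:[:1, - ([:0, 1:] ^ n):]:]"
    "a_poly - q_poly ^ n = [:[:- ([:0, 1:] ^ n), 1:]:]"
    "b_poly - q_poly ^ n = [:- [:[:0, 1:] ^ n:], 1:]"
    unfolding q_poly_power a_poly_def b_poly_def by (simp_all add: one_pCons)
  then show "prime_elem (1 - a_poly * q_poly ^ n)" "prime_elem (a_poly - q_poly ^ n)" "prime_elem (b_poly - q_poly ^ n)"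
    by (simp_all only: prime_elem_const_poly_iff) (rule prime_elem_linear_poly; simp)+
qed

text \<open>Irreducibility of r makes p an associate of it. Every zero of r is then a zero of p and
  can be used to refute divisibility by p.\<close>

lemma prime_dvd_prime_elem:
  fixes p r :: "'a::factorial_semiring"
  assumes "prime p" "p dvd r" "prime_elem r"
  shows "r dvd p"
  using assms by (metis irreducibleD' not_prime_unit prime_elem_imp_irreducible)

section \<open>Squarefreeness of the modulus\<close>

lemma qint_eq_sum:
  fixes x :: "'a::idom_divide"
  assumes "x \<noteq> 1"
  shows "qint x n = (\<Sum>i<n. x ^ i)"
  using assms by (simp add: qint_def one_diff_power_eq)

lemma q_poly_neq_1: "q_poly \<noteq> 1"
proof
  assume "q_poly = 1"
  then have "eval_qab 2 0 0 q_poly = eval_qab 2 0 0 1" by simp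
  then show False by simp
qed

text \<open>In characteristic 0 a repeated factor of 1 - X^n divides the derivative, hence X^n,
  hence 1.\<close>

lemma squarefree_one_minus_power:
  assumes "n > 0"
  shows "squarefree (1 - [:0, 1:] ^ n :: rat poly)"
proof (rule squarefreeI)
  fix f :: "rat poly" assume "f ^ 2 dvd 1 - [:0, 1:] ^ n"
  then obtain g where g: "1 - [:0, 1:] ^ n = f ^ 2 * g" by (auto simp: dvd_def)
  have "pderiv (1 - [:0, 1:] ^ n :: rat poly) = - smult (of_nat n) ([:0, 1:] ^ (n - 1))"
    using assms by (simp add: pderiv_diff pderiv_power pderiv_pCons)
  moreover have "f dvd pderiv (f ^ 2 * g)"
    by (simp add: pderiv_mult power2_eq_square)
  ultimately have "f dvd smult (of_nat n) ([:0, 1:] ^ (n - 1))"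
    unfolding g by simp
  then have "f dvd [:0, 1:] ^ (n - 1)"
    using assms by (simp add: dvd_smult_iff)
  then have "f dvd [:0, 1:] * [:0, 1:] ^ (n - 1)" by (rule dvd_mult)
  then have "f dvd [:0, 1:] ^ n" using assms by (simp flip: power_Suc)
  moreover have "f dvd 1 - [:0, 1:] ^ n" unfolding g by (simp add: power2_eq_square)
  ultimately have "f dvd (1 - [:0, 1:] ^ n) + [:0, 1:] ^ n" by (rule dvd_add[rotated])
  then show "f dvd 1" by simp
qed

lemma dvd_const_polyE:
  fixes c :: "'a::idom"
  assumes "f dvd [:c:]" "c \<noteq> 0"
  obtains d where "f = [:d:]" "d dvd c"
proof -
  have "degree f = 0" using dvd_imp_degree_le[OF assms(1)] assms(2) by simp
  then obtain d where "f = [:d:]" by (auto elim: degree_eq_zeroE)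
  with assms(1) that show ?thesis by simp
qed

lemma squarefree_const_poly:
  fixes c :: "'a::idom"
  assumes "squarefree c" shows "squarefree [:c:]"
proof (rule squarefreeI)
  fix f assume f: "f ^ 2 dvd [:c:]"
  have c: "c \<noteq> 0" using assms by auto
  have "f dvd [:c:]" using f by (metis dvd_trans dvd_triv_left power2_eq_square)
  then obtain d where d: "f = [:d:]" using c dvd_const_polyE by blast
  with f have "d ^ 2 dvd c" by (simp add: power2_eq_square)
  then show "f dvd 1" using assms squarefreeD d by (metis is_unit_const_poly_iff)
qed

lemma qint_q_poly: "qint q_poly n = [:[:\<Sum>i<n. [:0, 1:] ^ i:]:]"
proof -
  have "qint q_poly n = (\<Sum>i<n. [:[:[:0, 1:] ^ i:]:])"
    by (simp only: qint_eq_sum[OF q_poly_neq_1] q_poly_power)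
  also have "\<dots> = [:[:\<Sum>i<n. [:0, 1:] ^ i:]:]"
    by (induction n) simp_all
  finally show ?thesis .
qed

lemma squarefree_qint_q_poly:
  assumes "n > 0" shows "squarefree (qint q_poly n)"
proof -
  have "(\<Sum>i<n. [:0, 1:] ^ i) dvd (1 - [:0, 1:] ^ n :: rat poly)"
    by (simp add: one_diff_power_eq)
  then show ?thesis
    unfolding qint_q_poly using squarefree_one_minus_power[OF assms]
    by (intro squarefree_const_poly) (rule squarefree_mono)
qed

definition modulus :: "nat \<Rightarrow> qab_poly" where
  "modulus n = qint q_poly n * (1 - a_poly * q_poly ^ n) * (a_poly - q_poly ^ n) * (b_poly - q_poly ^ n)"

lemma prime_elem_coprime:
  fixes r s :: "'a::factorial_semiring"
  assumes "prime_elem r" "\<not> r dvd s"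
  shows "coprime r s"
proof -
  have "coprime s r"
  proof (rule coprime_prime_factorI)
    show "r \<noteq> 0" using assms(1) by auto
    show False if "prime p" "p dvd s" "p dvd r" for p
      using prime_dvd_prime_elem[OF that(1,3) assms(1)] that(2) assms(2) dvd_trans by blast
  qed
  then show ?thesis by (simp add: coprime_commute)
qed

lemma squarefree_modulus:
  assumes "n > 0" shows "squarefree (modulus n)"
proof -
  define x :: rat where "x = 2 ^ n"
  have x: "x > 1" using assms by (simp add: x_def)
  then have xx: "x * x \<noteq> 1" using less_1_mult[of x x] by simp
  have e: "eval_qab 2 y z (qint q_poly n) = x - 1" for y z
  proof -
    have "qint q_poly n * (1 - q_poly) = 1 - q_poly ^ n"
      unfolding qint_eq_sum[OF q_poly_neq_1] by (simp add: one_diff_power_eq)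
    then have "eval_qab 2 y z (qint q_poly n) * (1 - 2) = 1 - x"
      by (metis eval_qab_simps(2-5,7) x_def)
    then show ?thesis by simp
  qed
  note r = prime_elem_modulus_factors[of n]
  \<comment> \<open>The test points have q = 2, so that q^n > 1 and [n] is nonzero; a or b is then
    placed on the zero set of the factor under test, off the zero sets of the preceding
    factors.\<close>
  have "\<not> 1 - a_poly * q_poly ^ n dvd qint q_poly n"
    by (rule not_dvd_of_eval_qab[of 2 "1 / x" 0]) (use x xx e in \<open>simp_all flip: x_def\<close>)
  moreover have "\<not> a_poly - q_poly ^ n dvd qint q_poly n * (1 - a_poly * q_poly ^ n)"
    by (rule not_dvd_of_eval_qab[of 2 x 0]) (use x xx e in \<open>auto simp flip: x_def\<close>)
  moreover have "\<not> b_poly - q_poly ^ n dvd qint q_poly n * (1 - a_poly * q_poly ^ n) * (a_poly - q_poly ^ n)"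
    by (rule not_dvd_of_eval_qab[of 2 0 x]) (use x xx e in \<open>auto simp flip: x_def\<close>)
  ultimately have "coprime (1 - a_poly * q_poly ^ n) (qint q_poly n)"
    "coprime (a_poly - q_poly ^ n) (qint q_poly n * (1 - a_poly * q_poly ^ n))"
    "coprime (b_poly - q_poly ^ n) (qint q_poly n * (1 - a_poly * q_poly ^ n) * (a_poly - q_poly ^ n))"
    using r by (blast intro: prime_elem_coprime)+
  then show ?thesis
    unfolding modulus_def using r squarefree_qint_q_poly[OF assms]
    by (intro squarefree_mult_coprime) (simp_all only: coprime_commute squarefree_prime_elem)
qed

text \<open>Collects what makes the parameters and denominators units at p, apart from the factors 1
  - q^j, which behave differently at the primes of [n]. The restriction to even j matters: the
  denominators (aq^4;q^4)_k and (q^4/a;q^4)_k involve only even powers of q, whereas p may divide 1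
  - aq^n or a - q^n with n odd.\<close>

definition generic_prime :: "qab_poly \<Rightarrow> bool" where
  "generic_prime p \<longleftrightarrow> prime_elem p \<and> \<not> p dvd q_poly \<and> \<not> p dvd a_poly \<and> \<not> p dvd b_poly
    \<and> \<not> p dvd a_poly - b_poly \<and> \<not> p dvd 1 - a_poly * b_poly
    \<and> (\<forall>j. even j \<longrightarrow> \<not> p dvd 1 - a_poly * q_poly ^ j \<and> \<not> p dvd a_poly - q_poly ^ j)
    \<and> (\<forall>j. \<not> p dvd 1 - b_poly ^ 3 * q_poly ^ j)"

lemma not_dvd_of_eval_qab_assoc:
  assumes "r dvd p" "eval_qab x y z r = 0" "eval_qab x y z f \<noteq> 0"
  shows "\<not> p dvd f"
  using not_dvd_of_eval_qab[OF assms(2,3)] assms(1) dvd_trans by blast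

lemma power_two_injective: "(2 ^ i :: rat) = 2 ^ j \<longleftrightarrow> i = j"
  by (simp add: power_inject_exp)

text \<open>The point q = 2, a = 2^(-n), b = 0 is a zero of 1 - aq^n and hence of p; b = 1 replaces
  b = 0 where b itself is tested. An even j cannot equal n.\<close>

lemma generic_prime_1_minus_aqn:
  assumes p: "prime p" and "p dvd 1 - a_poly * q_poly ^ n" "odd n"
  shows "generic_prime p" "j > 0 \<Longrightarrow> \<not> p dvd 1 - q_poly ^ j"
proof -
  note r = prime_dvd_prime_elem[OF p assms(2) prime_elem_modulus_factors(1)]
  note nd = not_dvd_of_eval_qab_assoc[OF r, of 2 "1 / 2 ^ n" 0]
  show "generic_prime p"
    unfolding generic_prime_def
  proof (intro conjI allI impI)
    show "prime_elem p" using p by simp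
    show "\<not> p dvd b_poly"
      by (rule not_dvd_of_eval_qab_assoc[OF r, of 2 "1 / 2 ^ n" 1]) auto
    fix j :: nat assume "even j"
    then have j: "j \<noteq> n" "n + j \<noteq> 0" using \<open>odd n\<close> odd_pos[of n] by auto
    show "\<not> p dvd 1 - a_poly * q_poly ^ j"
      by (rule nd) (use j in \<open>auto simp: field_simps power_two_injective\<close>)
    show "\<not> p dvd a_poly - q_poly ^ j"
      by (rule nd) (use j power_two_injective[of "n + j" 0] in \<open>auto simp: field_simps power_add\<close>)
  qed (rule nd; auto)+
  show "\<not> p dvd 1 - q_poly ^ j" if "j > 0"
    by (rule nd) (use that power_two_injective[of j 0] in auto)
qed

lemma generic_prime_a_minus_qn:
  assumes p: "prime p" and "p dvd a_poly - q_poly ^ n" "odd n"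
  shows "generic_prime p" "j > 0 \<Longrightarrow> \<not> p dvd 1 - q_poly ^ j"
proof -
  note r = prime_dvd_prime_elem[OF p assms(2) prime_elem_modulus_factors(2)]
  note nd = not_dvd_of_eval_qab_assoc[OF r, of 2 "2 ^ n" 0]
  show "generic_prime p"
    unfolding generic_prime_def
  proof (intro conjI allI impI)
    show "prime_elem p" using p by simp
    show "\<not> p dvd b_poly"
      by (rule not_dvd_of_eval_qab_assoc[OF r, of 2 "2 ^ n" 1]) auto
    fix j :: nat assume "even j"
    then have j: "j \<noteq> n" "n + j \<noteq> 0" using \<open>odd n\<close> odd_pos[of n] by auto
    show "\<not> p dvd 1 - a_poly * q_poly ^ j"
      by (rule nd) (use j power_two_injective[of "n + j" 0] in \<open>auto simp: power_add\<close>)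
    show "\<not> p dvd a_poly - q_poly ^ j"
      by (rule nd) (use j in \<open>auto simp: power_two_injective\<close>)
  qed (rule nd; auto)+
  show "\<not> p dvd 1 - q_poly ^ j" if "j > 0"
    by (rule nd) (use that power_two_injective[of j 0] in auto)
qed

lemma generic_prime_b_minus_qn:
  assumes p: "prime p" and "p dvd b_poly - q_poly ^ n" "odd n"
  shows "generic_prime p" "j > 0 \<Longrightarrow> \<not> p dvd 1 - q_poly ^ j"
proof -
  note r = prime_dvd_prime_elem[OF p assms(2) prime_elem_modulus_factors(3)]
  note nd = not_dvd_of_eval_qab_assoc[OF r, of 2 0 "2 ^ n"]
  show "generic_prime p"
    unfolding generic_prime_def
  proof (intro conjI allI impI)
    show "prime_elem p" using p by simp
    show "\<not> p dvd a_poly"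
      by (rule not_dvd_of_eval_qab_assoc[OF r, of 2 1 "2 ^ n"]) auto
    fix j :: nat
    have j: "3 * n + j \<noteq> 0" using \<open>odd n\<close> by (auto elim: oddE)
    show "\<not> p dvd 1 - b_poly ^ 3 * q_poly ^ j"
      by (rule nd) (use j power_two_injective[of "3 * n + j" 0] in \<open>auto simp: power_add power_mult power_mult_distrib mult.commute[of 3 n]\<close>)
  qed (rule nd; auto)+
  show "\<not> p dvd 1 - q_poly ^ j" if "j > 0"
    by (rule nd) (use that power_two_injective[of j 0] in auto)
qed

lemma dvd_const_const_eval:
  fixes f :: qab_poly
  assumes "[:[:c:]:] dvd f"
  shows "c dvd poly (poly f z) y"
  using assms by (auto simp: dvd_def)

text \<open>A prime divisor of [n] is a polynomial c in q alone, so setting a and b to 0 or 1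
  preserves divisibility by c and leaves 1, -1 or a power of q up to sign. The latter is prime to c
  because q^n is 1 modulo c.\<close>

lemma generic_prime_qint:
  assumes p: "prime p" and "p dvd qint q_poly n" "n > 0"
  shows "generic_prime p" "\<not> p dvd 1 - q_poly" "p dvd 1 - q_poly ^ n"
proof -
  have s0: "(\<Sum>i<n. [:0, 1:] ^ i :: rat poly) \<noteq> 0"
    using squarefree_qint_q_poly[OF assms(3)] unfolding qint_q_poly by auto
  obtain c where c: "p = [:[:c:]:]"
    using assms(2) s0 unfolding qint_q_poly
    by (elim dvd_const_polyE) (auto elim: dvd_const_polyE)
  have c1: "\<not> c dvd 1"
    using p unfolding c by (metis is_unit_const_poly_iff not_prime_unit)
  have eq: "(1 - q_poly) * qint q_poly n = 1 - q_poly ^ n"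
    unfolding qint_eq_sum[OF q_poly_neq_1] by (simp add: one_diff_power_eq)
  then show pn: "p dvd 1 - q_poly ^ n"
    using assms(2) by (metis dvd_mult)
  show "\<not> p dvd 1 - q_poly"
  proof
    assume d: "p dvd 1 - q_poly"
    have "p dvd 1 - q_poly ^ i" for i
      using d by (simp add: one_diff_power_eq)
    \<comment> \<open>The first sum is n - [n], so p would divide the nonzero constant n.\<close>
    then have "p dvd (\<Sum>i<n. 1 - q_poly ^ i) + qint q_poly n"
      using assms(2) by (intro dvd_add dvd_sum) auto
    then have "p dvd of_nat n"
      unfolding qint_eq_sum[OF q_poly_neq_1] sum.distrib[symmetric] by simp
    then have "c dvd of_nat n"
      unfolding c using dvd_const_const_eval[of c "of_nat n" 0 0] by simp
    moreover have "(of_nat n :: rat poly) dvd 1"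
      using assms(3) by (simp add: of_nat_poly is_unit_pCons_iff)
    ultimately show False using c1 dvd_trans by blast
  qed
  have X: "\<not> p dvd q_poly ^ j" for j
  proof
    assume "p dvd q_poly ^ j"
    then have "p dvd q_poly" using p prime_dvd_power by blast
    then have "p dvd q_poly ^ n" using \<open>n > 0\<close> by (simp add: dvd_power_iff_le dvd_trans[OF _ dvd_power])
    then have "p dvd (1 - q_poly ^ n) + q_poly ^ n" using pn dvd_add by blast
    then show False using p by (simp add: not_prime_unit)
  qed
  have Xc: "\<not> c dvd [:0, 1:] ^ j" for j
    using X[of j] unfolding c q_poly_power by simp
  have nd: "\<not> p dvd f" if "\<not> c dvd poly (poly f [:[:z:]:]) [:y:]" for f y z
    using dvd_const_const_eval[of c f] that unfolding c by blast
  show "generic_prime p"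
    unfolding generic_prime_def
  proof (intro conjI allI impI)
    show "prime_elem p" using p by simp
    show "\<not> p dvd q_poly" using X[of 1] by simp
    show "\<not> p dvd a_poly" by (rule nd[where y = 1 and z = 0]) (use c1 in \<open>simp add: a_poly_def one_pCons[symmetric]\<close>)
    show "\<not> p dvd b_poly" by (rule nd[where y = 0 and z = 1]) (use c1 in \<open>simp add: b_poly_def one_pCons[symmetric]\<close>)
    show "\<not> p dvd a_poly - b_poly"
      by (rule nd[where y = 1 and z = 0]) (use c1 in \<open>simp add: a_poly_def b_poly_def one_pCons[symmetric]\<close>)
    show "\<not> p dvd 1 - a_poly * b_poly"
      by (rule nd[where y = 0 and z = 0]) (use c1 in \<open>simp add: a_poly_def b_poly_def\<close>)
    fix j
    show "\<not> p dvd 1 - a_poly * q_poly ^ j"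
      by (rule nd[where y = 0 and z = 0]) (use c1 in \<open>simp add: a_poly_def\<close>)
    show "\<not> p dvd a_poly - q_poly ^ j"
      by (rule nd[where y = 0 and z = 0]) (use Xc[of j] in \<open>simp add: a_poly_def q_poly_def\<close>)
    show "\<not> p dvd 1 - b_poly ^ 3 * q_poly ^ j"
      by (rule nd[where y = 0 and z = 0]) (use c1 in \<open>simp add: b_poly_def\<close>)
  qed
qed

section \<open>Congruences modulo the linear factors\<close>

lemma fract_cong_qpoch:
  "prime_elem p \<Longrightarrow> fract_cong p x y \<Longrightarrow> fract_cong p q r \<Longrightarrow> fract_cong p (qpoch x q n) (qpoch y r n)"
  unfolding qpoch_def
  by (intro fract_cong_prod fract_cong_diff fract_cong_1 fract_cong_mult fract_cong_power)

lemma fract_unit_qpoch: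
  "prime_elem p \<Longrightarrow> (\<And>j. j < n \<Longrightarrow> fract_unit p (1 - x * q ^ j)) \<Longrightarrow> fract_unit p (qpoch x q n)"
  unfolding qpoch_def by (intro fract_unit_prod) auto

lemma fract_cong_quad_term:
  assumes p: "prime_elem p" and q: "fract_cong p q q" and A: "fract_cong p A A'"
    and B: "fract_cong p B B'" and E: "fract_cong p E E'"
    and u: "fract_unit p B" "fract_unit p E"
    "\<And>j. j < k \<Longrightarrow> fract_unit p (1 - q ^ 4 * (q ^ 4) ^ j)"
    "\<And>j. j < k \<Longrightarrow> fract_unit p (1 - A * q ^ 4 / B * (q ^ 4) ^ j)"
    "\<And>j. j < k \<Longrightarrow> fract_unit p (1 - A * B * q ^ 2 * (q ^ 4) ^ j)"
    "\<And>j. j < k \<Longrightarrow> fract_unit p (1 - E * q ^ 2 * (q ^ 2) ^ j)"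
  shows "fract_cong p (quad_term q A B E k) (quad_term q A' B' E' k)"
  unfolding quad_term_def quad_core_def quad_den_def
  by (intro p fract_cong_divide[OF p] fract_cong_mult[OF p] fract_cong_diff[OF p] fract_cong_1[OF p]
      fract_cong_power[OF p] fract_cong_qpoch[OF p] fract_unit_mult[OF p] fract_unit_qpoch[OF p] q A B E u)

abbreviation qf :: qab_ratfun where "qf \<equiv> to_fract q_poly"
abbreviation af :: qab_ratfun where "af \<equiv> to_fract a_poly"
abbreviation bf :: qab_ratfun where "bf \<equiv> to_fract b_poly"

lemma poly_neqI: "eval_qab x y z f \<noteq> eval_qab x y z g \<Longrightarrow> f \<noteq> g"
  by auto

lemma qf_power_inj: "inj (\<lambda>i::nat. qf ^ i)"
proof (rule injI)
  fix i j :: nat assume "qf ^ i = qf ^ j"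
  then have "eval_qab 2 0 0 (q_poly ^ i) = eval_qab 2 0 0 (q_poly ^ j)"
    by (simp flip: to_fract_power)
  then show "i = j" by (simp add: power_two_injective)
qed

lemma indeterminates_nonzero: "qf \<noteq> 0" "af \<noteq> 0" "bf \<noteq> 0"
  using poly_neqI[of 1 1 1 q_poly 0] poly_neqI[of 1 1 1 a_poly 0] poly_neqI[of 1 1 1 b_poly 0] by simp_all

lemma qf_power_neq_1: "j > 0 \<Longrightarrow> qf ^ j \<noteq> 1"
  using injD[OF qf_power_inj, of j 0] by auto

lemma af_generic: "af * qf * qf ^ i \<noteq> qf ^ j"
proof -
  have "a_poly * q_poly * q_poly ^ i \<noteq> q_poly ^ j"
    by (rule poly_neqI[of 1 0 0]) simp
  then show ?thesis
    unfolding to_fract_power[symmetric] to_fract_mult[symmetric] to_fract_eq_iff .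
qed

lemma bf_generic: "bf ^ 3 * qf ^ j \<noteq> 1"
proof -
  have "b_poly ^ 3 * q_poly ^ j \<noteq> 1"
    by (rule poly_neqI[of 1 0 0]) simp
  then show ?thesis
    by (metis to_fract_1 to_fract_eq_iff to_fract_mult to_fract_power)
qed

lemma generic_prime_units:
  assumes "generic_prime p"
  shows "fract_unit p qf" "fract_unit p af" "fract_unit p bf" "fract_unit p (af - bf)"
    "fract_unit p (1 - af * bf)"
    "even j \<Longrightarrow> fract_unit p (1 - af * qf ^ j)" "even j \<Longrightarrow> fract_unit p (1 - qf ^ j / af)"
    "fract_unit p (1 - bf ^ 3 * qf ^ j)"
proof -
  have p: "prime_elem p" using assms by (simp add: generic_prime_def)
  note u = fract_unit_to_fract[OF p]
  show a: "fract_unit p af" using assms u unfolding generic_prime_def by blast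
  show "fract_unit p qf" "fract_unit p bf"
    using assms u unfolding generic_prime_def by blast+
  show "fract_unit p (af - bf)" "fract_unit p (1 - af * bf)" "fract_unit p (1 - bf ^ 3 * qf ^ j)"
    using assms u[of "a_poly - b_poly"] u[of "1 - a_poly * b_poly"] u[of "1 - b_poly ^ 3 * q_poly ^ j"]
    unfolding generic_prime_def by (simp_all add: to_fract_power)
  show "fract_unit p (1 - af * qf ^ j)" if "even j"
    using assms u[of "1 - a_poly * q_poly ^ j"] that unfolding generic_prime_def by (simp add: to_fract_power)
  show "fract_unit p (1 - qf ^ j / af)" if "even j"
  proof -
    have "fract_unit p (af - qf ^ j)"
      using assms u[of "a_poly - q_poly ^ j"] that unfolding generic_prime_def by (simp add: to_fract_power)
    from fract_unit_divide[OF p this a] show ?thesis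
      using indeterminates_nonzero by (simp add: diff_divide_distrib)
  qed
qed

lemma generic_prime_den_units:
  assumes "generic_prime p"
  shows "fract_unit p (1 - qf * qf ^ 4 / (af * qf) * (qf ^ 4) ^ j)"
    "fract_unit p (1 - qf * (af * qf) * qf ^ 2 * (qf ^ 4) ^ j)"
    "fract_unit p (1 - bf ^ 3 * qf ^ 2 * (qf ^ 2) ^ j)"
proof -
  have "qf * qf ^ 4 / (af * qf) * (qf ^ 4) ^ j = qf ^ (4 + 4 * j) / af"
    using indeterminates_nonzero unfolding power_add power_mult by simp
  moreover have "qf * (af * qf) * qf ^ 2 * (qf ^ 4) ^ j = af * qf ^ (4 + 4 * j)"
    unfolding power_add power_mult by (simp add: eval_nat_numeral)
  moreover have "bf ^ 3 * qf ^ 2 * (qf ^ 2) ^ j = bf ^ 3 * qf ^ (2 + 2 * j)"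
    unfolding power_add power_mult by simp
  ultimately show "fract_unit p (1 - qf * qf ^ 4 / (af * qf) * (qf ^ 4) ^ j)"
    "fract_unit p (1 - qf * (af * qf) * qf ^ 2 * (qf ^ 4) ^ j)"
    "fract_unit p (1 - bf ^ 3 * qf ^ 2 * (qf ^ 2) ^ j)"
    using generic_prime_units(6)[OF assms, of "4 + 4 * j"] generic_prime_units(7)[OF assms, of "4 + 4 * j"]
      generic_prime_units(8)[OF assms, of "2 + 2 * j"]
    by (simp_all only: even_add even_mult_iff even_numeral simp_thms)
qed

section \<open>The two sides and the gluing of the local values\<close>

definition lhs_sum :: "nat \<Rightarrow> qab_ratfun" where
  "lhs_sum n = (\<Sum>k<n. quad_term qf qf (af * qf) (bf ^ 3) k) / (1 - qf)"

definition rhs_b :: "nat \<Rightarrow> qab_ratfun" where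
  "rhs_b m = (qpoch (qf ^ 3) (qf ^ 4) m * qpoch (1 / bf ^ 3) (qf ^ 4) m)
    / (qpoch (1 / qf) (qf ^ 4) m * qpoch (bf ^ 3 * qf ^ 2) (qf ^ 4) m) * (bf ^ 3 / qf) ^ m"

definition rhs_a :: "nat \<Rightarrow> qab_ratfun" where
  "rhs_a m = (qpoch (qf ^ 3) (qf ^ 4) m * qpoch (qf ^ 5) (qf ^ 4) m)
    / (qpoch (af * qf ^ 4) (qf ^ 4) m * qpoch (qf ^ 4 / af) (qf ^ 4) m)"

lemma fract_cong_q: "prime_elem p \<Longrightarrow> fract_cong p qf qf"
  by (rule fract_cong_to_fract)

lemma fract_unit_rhs_a_den:
  assumes "generic_prime p"
  shows "fract_unit p (qpoch (af * qf ^ 4) (qf ^ 4) m * qpoch (qf ^ 4 / af) (qf ^ 4) m)"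
proof -
  have p: "prime_elem p" using assms by (simp add: generic_prime_def)
  have e: "qf ^ 4 / af * (qf ^ 4) ^ j = qf ^ (4 + 4 * j) / af"
    "af * qf ^ 4 * (qf ^ 4) ^ j = af * qf ^ (4 + 4 * j)" for j
    unfolding power_add power_mult by simp_all
  have "fract_unit p (1 - qf ^ 4 / af * (qf ^ 4) ^ j)" "fract_unit p (1 - af * qf ^ 4 * (qf ^ 4) ^ j)" for j
    unfolding e by (rule generic_prime_units[OF assms]; simp)+
  then show ?thesis
    by (intro fract_unit_mult[OF p] fract_unit_qpoch[OF p])
qed

lemma fract_cong_rhs_a:
  assumes "generic_prime p"
  shows "fract_cong p (rhs_a m) (rhs_a m)"
proof -
  have p: "prime_elem p" using assms by (simp add: generic_prime_def)
  show ?thesis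
    unfolding rhs_a_def
    by (rule fract_cong_divide[OF p _ fract_unit_imp_cong[OF p fract_unit_rhs_a_den[OF assms]] fract_unit_rhs_a_den[OF assms]])
      (intro fract_cong_mult[OF p] fract_cong_qpoch[OF p] fract_cong_power[OF p] fract_cong_q[OF p])
qed

lemma qpoch_ratio_telescope:
  assumes "m > 0"
  shows "(1 - 1 / qf) * qpoch (qf ^ 3) (qf ^ 4) m = (1 - qf ^ (4 * m - 1)) * qpoch (1 / qf) (qf ^ 4) m"
proof -
  have "(qf ^ 4) ^ m = qf * qf ^ (4 * m - 1)"
    using assms by (simp flip: power_mult power_Suc)
  then have "1 / qf * qf ^ 4 = qf ^ 3" "1 / qf * (qf ^ 4) ^ m = qf ^ (4 * m - 1)"
    using indeterminates_nonzero by (simp_all add: eval_nat_numeral)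
  then show ?thesis
    using qpoch_shift[of "1 / qf" "qf ^ 4" m] by (simp add: mult_ac)
qed

text \<open>(1/q;q^4)_m can have factors divisible by a prime of [n], for instance 1 - q^3 when n =
  15. Since q^3 is 1/q shifted by q^4, the quotient by it telescopes and leaves only 1 - 1/q in its
  denominator. For 4m - 1 = n the factor 1 - q^n becomes visible.\<close>

lemma rhs_b_alt:
  assumes "m > 0"
  shows "rhs_b m = (1 - qf ^ (4 * m - 1)) / (1 - 1 / qf)
     * (qpoch (1 / bf ^ 3) (qf ^ 4) m / qpoch (bf ^ 3 * qf ^ 2) (qf ^ 4) m) * (bf ^ 3 / qf) ^ m"
proof -
  have "qpoch (1 / qf) (qf ^ 4) m \<noteq> 0"
  proof (rule qpoch_nonzero)
    fix j
    have "(1::nat) \<noteq> 4 * j" by presburger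
    then have "qf ^ 1 \<noteq> qf ^ (4 * j)" using injD[OF qf_power_inj, of 1 "4 * j"] by auto
    then show "1 / qf * (qf ^ 4) ^ j \<noteq> 1"
      using indeterminates_nonzero by (simp add: power_mult)
  qed
  moreover have "1 - 1 / qf \<noteq> 0"
    using qf_power_neq_1[of 1] by auto
  ultimately have "qpoch (qf ^ 3) (qf ^ 4) m / qpoch (1 / qf) (qf ^ 4) m = (1 - qf ^ (4 * m - 1)) / (1 - 1 / qf)"
    using qpoch_ratio_telescope[OF assms] by (simp add: frac_eq_eq mult_ac)
  then show ?thesis
    by (simp only: rhs_b_def times_divide_times_eq[symmetric])
qed

lemma fract_unit_1_minus_inverse_q:
  assumes "generic_prime p" "\<not> p dvd 1 - q_poly"
  shows "fract_unit p (1 - qf)" "fract_unit p (1 - 1 / qf)"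
proof -
  have p: "prime_elem p" using assms by (simp add: generic_prime_def)
  show u: "fract_unit p (1 - qf)"
    using fract_unit_to_fract[OF p assms(2)] by simp
  have "1 - 1 / qf = - (1 - qf) / qf"
    using indeterminates_nonzero by (simp add: field_simps)
  then show "fract_unit p (1 - 1 / qf)"
    using u generic_prime_units(1)[OF assms(1)]
    by (simp only: fract_unit_divide[OF p] fract_unit_minus[OF p])
qed

lemma fract_cong_rhs_b_cofactor:
  assumes "generic_prime p"
  shows "fract_cong p (qpoch (1 / bf ^ 3) (qf ^ 4) m / qpoch (bf ^ 3 * qf ^ 2) (qf ^ 4) m)
    (qpoch (1 / bf ^ 3) (qf ^ 4) m / qpoch (bf ^ 3 * qf ^ 2) (qf ^ 4) m)"
    "fract_cong p ((bf ^ 3 / qf) ^ m) ((bf ^ 3 / qf) ^ m)"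
proof -
  have p: "prime_elem p" using assms by (simp add: generic_prime_def)
  note u = generic_prime_units[OF assms]
  have e: "bf ^ 3 * qf ^ 2 * (qf ^ 4) ^ j = bf ^ 3 * qf ^ (2 + 4 * j)" for j
    unfolding power_add power_mult by simp
  have den: "fract_unit p (qpoch (bf ^ 3 * qf ^ 2) (qf ^ 4) m)"
    by (rule fract_unit_qpoch[OF p]) (unfold e, rule u)
  have b3: "fract_unit p (bf ^ 3)" using u(3) p by (intro fract_unit_power)
  note c = fract_unit_imp_cong[OF p]
  show "fract_cong p (qpoch (1 / bf ^ 3) (qf ^ 4) m / qpoch (bf ^ 3 * qf ^ 2) (qf ^ 4) m)
    (qpoch (1 / bf ^ 3) (qf ^ 4) m / qpoch (bf ^ 3 * qf ^ 2) (qf ^ 4) m)"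
    by (rule fract_cong_divide[OF p _ c[OF den] den],
        intro fract_cong_qpoch p c fract_unit_divide fract_unit_1 b3 fract_unit_power u(1))
  show "fract_cong p ((bf ^ 3 / qf) ^ m) ((bf ^ 3 / qf) ^ m)"
    by (intro c fract_unit_power fract_unit_divide p b3 u)
qed

lemma fract_cong_rhs_b:
  assumes "generic_prime p" "\<not> p dvd 1 - q_poly" "m > 0"
  shows "fract_cong p (rhs_b m) (rhs_b m)"
proof -
  have p: "prime_elem p" using assms by (simp add: generic_prime_def)
  note u = fract_unit_1_minus_inverse_q(2)[OF assms(1,2)]
  show ?thesis
    unfolding rhs_b_alt[OF assms(3)]
    by (intro p fract_cong_mult fract_cong_rhs_b_cofactor assms fract_cong_divide fract_cong_diff fract_cong_1
      fract_cong_power fract_cong_q u fract_unit_imp_cong[OF p u])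
qed

text \<open>With Q = q^n this explains the factor ab - 1 - a^2 + aQ: it is the cofactor for which
  the first coefficient, a multiple of b - Q, is congruent to 1 modulo (1 - aQ)(a - Q), as in the
  Chinese remainder theorem.\<close>

lemma crt_coefficients:
  fixes a b Q :: "'a::field"
  assumes "(a - b) * (1 - a * b) \<noteq> 0"
  shows "(b - Q) * (a * b - 1 - a ^ 2 + a * Q) / ((a - b) * (1 - a * b))
    = 1 - (1 - a * Q) * (a - Q) / ((a - b) * (1 - a * b))"
proof -
  have "(b - Q) * (a * b - 1 - a ^ 2 + a * Q) = (a - b) * (1 - a * b) - (1 - a * Q) * (a - Q)"
    by algebra
  then show ?thesis
    by (simp only: diff_divide_distrib divide_self[OF assms])
qed

definition rhs_total :: "nat \<Rightarrow> qab_ratfun" where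
  "rhs_total n = (bf - qf ^ n) * (af * bf - 1 - af ^ 2 + af * qf ^ n) / ((af - bf) * (1 - af * bf)) * rhs_b ((n + 1) div 4)
     + (1 - af * qf ^ n) * (af - qf ^ n) / ((af - bf) * (1 - af * bf)) * rhs_a ((3 * n - 1) div 4)"

lemma fract_cong_crt:
  assumes "generic_prime p"
  shows "fract_cong p x 0 \<Longrightarrow> fract_cong p y y \<Longrightarrow> fract_cong p (x * y / ((af - bf) * (1 - af * bf))) 0"
    and "fract_cong p y y \<Longrightarrow> fract_cong p (y / ((af - bf) * (1 - af * bf))) (y / ((af - bf) * (1 - af * bf)))"
    and "(af - bf) * (1 - af * bf) \<noteq> 0"
proof -
  have p: "prime_elem p" using assms by (simp add: generic_prime_def)
  have u: "fract_unit p ((af - bf) * (1 - af * bf))"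
    using generic_prime_units[OF assms] by (intro fract_unit_mult p)
  show "(af - bf) * (1 - af * bf) \<noteq> 0" using fract_unit_nonzero[OF p u] .
  show "fract_cong p (y / ((af - bf) * (1 - af * bf))) (y / ((af - bf) * (1 - af * bf)))" if "fract_cong p y y"
    using fract_cong_divide[OF p that fract_unit_imp_cong[OF p u] u] .
  show "fract_cong p (x * y / ((af - bf) * (1 - af * bf))) 0" if "fract_cong p x 0" "fract_cong p y y"
    using fract_cong_divide[OF p fract_cong_0_mult[OF p that] fract_unit_imp_cong[OF p u] u] by simp
qed

lemma fract_cong_of_dvd:
  assumes "prime_elem p" "p dvd f"
  shows "fract_cong p (to_fract f) 0"
  using fract_cong_dvd[of p f 0] assms by simp

lemma fract_unit_of_not_dvd:
  assumes "prime_elem p" "\<not> p dvd 1 - q_poly ^ j"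
  shows "fract_unit p (1 - qf ^ j)"
  using fract_unit_to_fract[OF assms] by (simp add: to_fract_power)

lemma fract_cong_summand:
  assumes g: "generic_prime p" and "fract_cong p qf A" "fract_cong p (af * qf) B" "fract_cong p (bf ^ 3) E"
    and k: "\<And>j. j < k \<Longrightarrow> \<not> p dvd 1 - q_poly ^ (4 + 4 * j)"
  shows "fract_cong p (quad_term qf qf (af * qf) (bf ^ 3) k) (quad_term qf A B E k)"
proof (rule fract_cong_quad_term)
  show p: "prime_elem p" using g by (simp add: generic_prime_def)
  show "fract_cong p qf qf" by (rule fract_cong_q[OF p])
  show "fract_unit p (af * qf)" "fract_unit p (bf ^ 3)"
    by (intro fract_unit_mult[OF p] fract_unit_power[OF p] generic_prime_units[OF g])+
  fix j assume "j < k"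
  have "qf ^ 4 * (qf ^ 4) ^ j = qf ^ (4 + 4 * j)"
    unfolding power_add power_mult ..
  then show "fract_unit p (1 - qf ^ 4 * (qf ^ 4) ^ j)"
    using fract_unit_of_not_dvd[OF p k[OF \<open>j < k\<close>]] by simp
qed (use assms generic_prime_den_units[OF g] in blast)+

text \<open>Meant for the linear factors of the modulus. There no positive power of q is 1 modulo p,
  so every (q^4;q^4)_k is a unit and the parameters may be replaced term by term over the whole
  range.\<close>

lemma fract_cong_lhs_sum:
  assumes g: "generic_prime p" and "fract_cong p (af * qf) B" "fract_cong p (bf ^ 3) E"
    and nd: "\<And>j. j > 0 \<Longrightarrow> \<not> p dvd 1 - q_poly ^ j"
  shows "fract_cong p (lhs_sum n) ((\<Sum>k<n. quad_term qf qf B E k) / (1 - qf))"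
proof -
  have p: "prime_elem p" using g by (simp add: generic_prime_def)
  have u: "fract_unit p (1 - qf)" using fract_unit_of_not_dvd[OF p nd[of 1]] by simp
  show ?thesis
    unfolding lhs_sum_def
    by (rule fract_cong_divide[OF p fract_cong_sum[OF p] fract_unit_imp_cong[OF p u] u],
        rule fract_cong_summand[OF g fract_cong_q[OF p] assms(2,3)]) (rule nd, simp)
qed

lemma fract_cong_rhs_total:
  assumes g: "generic_prime p" and nd: "\<not> p dvd 1 - q_poly" and n: "n mod 4 = 3"
  shows "fract_cong p (bf - qf ^ n) 0 \<Longrightarrow> fract_cong p (rhs_total n) (rhs_a ((3 * n - 1) div 4))"
    and "fract_cong p ((1 - af * qf ^ n) * (af - qf ^ n)) 0 \<Longrightarrow> fract_cong p (rhs_total n) (rhs_b ((n + 1) div 4))"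
proof -
  have p: "prime_elem p" using g by (simp add: generic_prime_def)
  have m: "(n + 1) div 4 > 0" using n by presburger
  note c = fract_cong_rhs_a[OF g, of "(3 * n - 1) div 4"] fract_cong_rhs_b[OF g nd m]
  note nz = fract_cong_crt(3)[OF g]
  define c1 where "c1 = (bf - qf ^ n) * (af * bf - 1 - af ^ 2 + af * qf ^ n) / ((af - bf) * (1 - af * bf))"
  define c2 where "c2 = (1 - af * qf ^ n) * (af - qf ^ n) / ((af - bf) * (1 - af * bf))"
  have c12: "c1 = 1 - c2"
    unfolding c1_def c2_def by (rule crt_coefficients[OF nz])
  have tot: "rhs_total n = c1 * rhs_b ((n + 1) div 4) + c2 * rhs_a ((3 * n - 1) div 4)"
    by (simp add: rhs_total_def c1_def c2_def)
  show "fract_cong p (rhs_total n) (rhs_a ((3 * n - 1) div 4))" if "fract_cong p (bf - qf ^ n) 0"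
  proof -
    have "fract_cong p (af * bf - 1 - af ^ 2 + af * qf ^ n) (af * bf - 1 - af ^ 2 + af * qf ^ n)"
      using fract_cong_to_fract[OF p, of "a_poly * b_poly - 1 - a_poly ^ 2 + a_poly * q_poly ^ n"]
      by (simp add: to_fract_power)
    then have "fract_cong p c1 0"
      unfolding c1_def using fract_cong_crt(1)[OF g that] by simp
    \<comment> \<open>Because the coefficients add up to 1, the total is the surviving value plus
      the vanishing coefficient times an integral difference.\<close>
    from fract_cong_add[OF p fract_cong_0_mult[OF p this fract_cong_diff[OF p c(2,1)]] c(1)]
    have "fract_cong p (c1 * (rhs_b ((n + 1) div 4) - rhs_a ((3 * n - 1) div 4)) + rhs_a ((3 * n - 1) div 4))
      (rhs_a ((3 * n - 1) div 4))" by simp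
    then show ?thesis
      unfolding tot c12 by (simp add: algebra_simps)
  qed
  show "fract_cong p (rhs_total n) (rhs_b ((n + 1) div 4))" if "fract_cong p ((1 - af * qf ^ n) * (af - qf ^ n)) 0"
  proof -
    have "fract_cong p c2 0"
      unfolding c2_def using fract_cong_crt(1)[OF g that fract_cong_1[OF p]] by simp
    from fract_cong_add[OF p fract_cong_0_mult[OF p this fract_cong_diff[OF p c]] c(2)]
    have "fract_cong p (c2 * (rhs_a ((3 * n - 1) div 4) - rhs_b ((n + 1) div 4)) + rhs_b ((n + 1) div 4))
      (rhs_b ((n + 1) div 4))" by simp
    then show ?thesis
      unfolding tot c12 by (simp add: algebra_simps)
  qed
qed

lemma sum_eq_rhs_a:
  assumes "M < n"
  shows "(\<Sum>k<n. quad_term qf qf (af * qf) (qf * qf ^ (4 * M)) k) / (1 - qf) = rhs_a M"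
proof -
  have e: "qf * qf ^ 2 = qf ^ 3" "qf * qf ^ 4 = qf ^ 5" "qf * (af * qf) * qf ^ 2 = af * qf ^ 4"
    "qf * qf ^ 4 / (af * qf) = qf ^ 4 / af"
    using indeterminates_nonzero by (simp_all add: eval_nat_numeral)
  have 1: "qf * qf ^ (j + 2) \<noteq> 1" for j
    using qf_power_neq_1[of "Suc (j + 2)"] by simp
  have 2: "qf * qf ^ 4 / (af * qf) * (qf ^ 4) ^ k \<noteq> 1" for k
  proof
    assume "qf * qf ^ 4 / (af * qf) * (qf ^ 4) ^ k = 1"
    then have "qf * qf ^ 4 * (qf ^ 4) ^ k = af * qf * qf ^ 0"
      using indeterminates_nonzero by (auto simp: field_simps)
    then have "af * qf * qf ^ 0 = qf ^ (1 + 4 + 4 * k)"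
      unfolding power_add power_mult power_one_right by (rule sym)
    then show False using af_generic by blast
  qed
  have 3: "qf * (af * qf) * qf ^ 2 * (qf ^ 4) ^ k \<noteq> 1" for k
  proof
    assume "qf * (af * qf) * qf ^ 2 * (qf ^ 4) ^ k = 1"
    then have "af * qf * qf ^ (1 + 2 + 4 * k) = qf ^ 0"
      unfolding power_add power_mult by (simp add: mult_ac)
    then show False using af_generic by blast
  qed
  have "1 - qf \<noteq> 0" using qf_power_neq_1[of 1] by simp
  moreover have "af * qf \<noteq> 0" using indeterminates_nonzero by simp
  ultimately show ?thesis
    using sum_quad_term_param[OF qf_power_inj indeterminates_nonzero(1,1) _ 1 2 3 assms]
    unfolding e(4) unfolding e(1-3) rhs_a_def by simp
qed

lemma sum_eq_rhs_b:
  assumes "0 < m" "2 * m \<le> n"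
  shows "(\<Sum>k<n. quad_term qf qf (qf ^ 2 / qf ^ (4 * m)) (bf ^ 3) k) / (1 - qf) = rhs_b m"
proof -
  have "1 - qf \<noteq> 0" using qf_power_neq_1[of 1] by simp
  moreover have "bf ^ 3 \<noteq> 0" using indeterminates_nonzero by simp
  ultimately show ?thesis
    using sum_quad_term_numer[OF qf_power_inj indeterminates_nonzero(1) _ bf_generic assms]
    unfolding rhs_b_def by simp
qed

lemma fract_cong_modulo_b_factor:
  assumes p: "prime p" "p dvd b_poly - q_poly ^ n" and n: "n mod 4 = 3"
  shows "fract_cong p (lhs_sum n) (rhs_total n)"
proof -
  have odd: "odd n" using n by presburger
  note g = generic_prime_b_minus_qn(1)[OF p odd] and nq = generic_prime_b_minus_qn(2)[OF p odd]
  have pe: "prime_elem p" using p by simp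
  \<comment> \<open>3n = 4M + 1, so b^3 is congruent to q^(3n) = q q^(4M), the terminating case of
    the parameter E.\<close>
  define M where "M = (3 * n - 1) div 4"
  have M: "3 * n = Suc (4 * M)" "M < n" unfolding M_def using n by presburger+
  have "fract_cong p (bf ^ 3) ((qf ^ n) ^ 3)"
    using fract_cong_dvd[OF pe p(2)] by (intro fract_cong_power[OF pe]) (simp add: to_fract_power)
  also have "(qf ^ n) ^ 3 = qf * qf ^ (4 * M)"
    unfolding power_Suc[symmetric] M(1)[symmetric] by (simp add: mult.commute flip: power_mult)
  finally have E: "fract_cong p (bf ^ 3) (qf * qf ^ (4 * M))" .
  have "fract_cong p (af * qf) (af * qf)"
    using fract_cong_to_fract[OF pe, of "a_poly * q_poly"] by simp
  then have "fract_cong p (lhs_sum n) (rhs_a M)"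
    unfolding sum_eq_rhs_a[OF M(2), symmetric]
    by (rule fract_cong_lhs_sum[OF g _ E]) (rule nq)
  moreover have "fract_cong p (rhs_total n) (rhs_a M)"
    unfolding M_def
  proof (rule fract_cong_rhs_total(1)[OF g _ n])
    show "\<not> p dvd 1 - q_poly" using nq[of 1] by simp
    show "fract_cong p (bf - qf ^ n) 0"
      using fract_cong_of_dvd[OF pe p(2)] by (simp add: to_fract_power)
  qed
  ultimately show ?thesis
    using fract_cong_trans[OF pe _ fract_cong_sym] by blast
qed

text \<open>At a = q^n it is q/a, not aq, that equals q^(2-4m), while the closed form is stated for
  the parameter B. Exchanging B with q^2/B also exchanges the two denominators AB q^2 and
  Aq^4/B.\<close>

lemma quad_term_symmetric:
  assumes "B \<noteq> 0" "q \<noteq> 0"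
  shows "quad_term q A (q ^ 2 / B) E k = quad_term q A B E k"
proof -
  have "A * q ^ 4 / (q ^ 2 / B) = A * B * q ^ 2" "A * (q ^ 2 / B) * q ^ 2 = A * q ^ 4 / B" "q ^ 2 / (q ^ 2 / B) = B"
    using assms by (simp_all add: field_simps eval_nat_numeral)
  then show ?thesis
    unfolding quad_term_def quad_core_def quad_den_def by (simp add: mult_ac)
qed

lemma fract_cong_modulo_a_factors:
  assumes p: "prime p" "p dvd a_poly - q_poly ^ n \<or> p dvd 1 - a_poly * q_poly ^ n" and n: "n mod 4 = 3"
  shows "fract_cong p (lhs_sum n) (rhs_total n)"
proof -
  have odd: "odd n" using n by presburger
  have g: "generic_prime p" and nq: "\<And>j. j > 0 \<Longrightarrow> \<not> p dvd 1 - q_poly ^ j"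
    using p(2) generic_prime_a_minus_qn[OF p(1) _ odd] generic_prime_1_minus_aqn[OF p(1) _ odd] by blast+
  have pe: "prime_elem p" using p by simp
  define m where "m = (n + 1) div 4"
  have m: "n + 1 = 4 * m" "0 < m" "2 * m \<le> n" unfolding m_def using n by presburger+
  have q0: "qf \<noteq> 0" by (rule indeterminates_nonzero)
  have q1: "qf ^ n * qf = qf ^ (4 * m)" unfolding m(1)[symmetric] by simp
  have E: "fract_cong p (bf ^ 3) (bf ^ 3)"
    using fract_cong_to_fract[OF pe, of "b_poly ^ 3"] by (simp add: to_fract_power)
  have "fract_cong p (lhs_sum n) (rhs_b m)"
    using p(2)
  proof
    assume "p dvd a_poly - q_poly ^ n"
    then have "fract_cong p (af * qf) (qf ^ n * qf)"
      using fract_cong_dvd[OF pe, of a_poly "q_poly ^ n"]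
      by (intro fract_cong_mult[OF pe] fract_cong_q[OF pe]) (simp add: to_fract_power)
    then have "fract_cong p (lhs_sum n) ((\<Sum>k<n. quad_term qf qf (qf ^ n * qf) (bf ^ 3) k) / (1 - qf))"
      by (rule fract_cong_lhs_sum[OF g _ E]) (rule nq)
    also have "(\<Sum>k<n. quad_term qf qf (qf ^ n * qf) (bf ^ 3) k)
        = (\<Sum>k<n. quad_term qf qf (qf ^ 2 / qf ^ (4 * m)) (bf ^ 3) k)"
      unfolding q1 using q0 by (simp add: quad_term_symmetric)
    finally show ?thesis unfolding sum_eq_rhs_b[OF m(2,3)] .
  next
    assume d: "p dvd 1 - a_poly * q_poly ^ n"
    have "fract_cong p 1 (af * qf ^ n)"
      using fract_cong_dvd[OF pe d] by (simp add: to_fract_power)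
    \<comment> \<open>Multiplying aq^n, which is congruent to 1, by this unit shows that aq is
      congruent to q^(1-n) = q^(2-4m).\<close>
    moreover have u: "fract_unit p (qf / qf ^ n)"
      by (intro fract_unit_divide[OF pe] fract_unit_power[OF pe] generic_prime_units[OF g])
    ultimately have c: "fract_cong p (af * qf ^ n * (qf / qf ^ n)) (1 * (qf / qf ^ n))"
      by (intro fract_cong_mult[OF pe] fract_unit_imp_cong[OF pe] fract_cong_sym[of p 1])
    have e: "1 * (qf / qf ^ n) = qf ^ 2 / qf ^ (4 * m)" "af * qf ^ n * (qf / qf ^ n) = af * qf"
      unfolding q1[symmetric] using q0 by (simp_all add: power2_eq_square)
    show ?thesis
      unfolding sum_eq_rhs_b[OF m(2,3), symmetric]
      by (rule fract_cong_lhs_sum[OF g c[unfolded e] E]) (rule nq)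
  qed
  moreover have "fract_cong p (rhs_total n) (rhs_b m)"
    unfolding m_def
  proof (rule fract_cong_rhs_total(2)[OF g _ n])
    show "\<not> p dvd 1 - q_poly" using nq[of 1] by simp
    have "p dvd (1 - a_poly * q_poly ^ n) * (a_poly - q_poly ^ n)" using p(2) by auto
    from fract_cong_of_dvd[OF pe this] show "fract_cong p ((1 - af * qf ^ n) * (af - qf ^ n)) 0"
      by (simp add: to_fract_power)
  qed
  ultimately show ?thesis
    using fract_cong_trans[OF pe _ fract_cong_sym] by blast
qed

section \<open>The congruence modulo the q-integer\<close>

text \<open>The summand without its factor 1 - q^(6k+1), which leaves a pure product over the index
  with value 1 at k = 0.\<close>

definition core_ratio :: "nat \<Rightarrow> qab_ratfun" where
  "core_ratio k = quad_core qf qf (af * qf) (qf ^ 2 / (af * qf)) (qf / bf ^ 3) (bf ^ 3) k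
     / quad_den qf (qf * qf ^ 4 / (af * qf)) (qf * (af * qf) * qf ^ 2) (bf ^ 3) k"

text \<open>The quotient of consecutive values of \<open>core_ratio\<close>, as a function of u =
  q^(2k), with 1 - q^(2k+1) and 1 - q^(4k+4) split off. Those two may be divisible by p; the rest is
  integral at every generic prime and depends only on u modulo p.\<close>

definition step_cofactor :: "qab_ratfun \<Rightarrow> qab_ratfun" where
  "step_cofactor u = ((1 - af * qf * u) * (1 - qf ^ 2 / (af * qf) * u) * (1 - qf / bf ^ 3 * u ^ 2) * (bf ^ 3 * qf ^ 2 * u))
     / ((1 - qf * qf ^ 4 / (af * qf) * u ^ 2) * (1 - qf * (af * qf) * qf ^ 2 * u ^ 2) * (1 - bf ^ 3 * qf ^ 2 * u))"

lemma quad_term_core_ratio: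
  "quad_term qf qf (af * qf) (bf ^ 3) k = (1 - qf * qf ^ (6 * k)) * core_ratio k"
  by (simp add: quad_term_def core_ratio_def)

lemma core_ratio_0: "core_ratio 0 = 1"
  by (simp add: core_ratio_def quad_core_def quad_den_def)

lemma core_ratio_Suc:
  "core_ratio (Suc k) = core_ratio k * ((1 - qf ^ (2 * k + 1)) / (1 - qf ^ (4 * k + 4)) * step_cofactor (qf ^ (2 * k)))"
proof -
  have e: "qf * qf ^ (2 * k) = qf ^ (2 * k + 1)" "qf ^ 4 * (qf ^ (2 * k)) ^ 2 = qf ^ (4 * k + 4)"
    by (simp_all add: power_add mult.commute flip: power_mult)
  show ?thesis
    unfolding core_ratio_def quad_core_Suc quad_den_Suc step_cofactor_def times_divide_times_eq
    unfolding e by (simp only: mult_ac)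
qed

lemma core_ratio_add:
  "core_ratio (s + k) = core_ratio s * (\<Prod>j<k. (1 - qf ^ (2 * (s + j) + 1)) / (1 - qf ^ (4 * (s + j) + 4))
     * step_cofactor (qf ^ (2 * (s + j))))"
proof (induction k)
  case (Suc k)
  show ?case
    unfolding add_Suc_right core_ratio_Suc Suc.IH prod.lessThan_Suc by (simp only: mult.assoc)
qed simp

lemma fract_cong_step_cofactor:
  assumes g: "generic_prime p" and u: "fract_cong p (qf ^ (2 * j)) v"
  shows "fract_cong p (step_cofactor (qf ^ (2 * j))) (step_cofactor v)"
proof -
  have p: "prime_elem p" using g by (simp add: generic_prime_def)
  note i = fract_unit_imp_cong[OF p]
  have e: "(qf ^ (2 * j)) ^ 2 = (qf ^ 4) ^ j" "qf ^ (2 * j) = (qf ^ 2) ^ j"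
    by (simp_all flip: power_mult)
  have den: "fract_unit p ((1 - qf * qf ^ 4 / (af * qf) * (qf ^ (2 * j)) ^ 2)
      * (1 - qf * (af * qf) * qf ^ 2 * (qf ^ (2 * j)) ^ 2) * (1 - bf ^ 3 * qf ^ 2 * qf ^ (2 * j)))"
    unfolding e(1) unfolding e(2) by (intro fract_unit_mult[OF p] generic_prime_den_units[OF g])
  note gu = generic_prime_units(1-3)[OF g]
  have a: "fract_cong p (af * qf) (af * qf)" "fract_cong p (qf ^ 2 / (af * qf)) (qf ^ 2 / (af * qf))"
    "fract_cong p (qf / bf ^ 3) (qf / bf ^ 3)" "fract_cong p (bf ^ 3 * qf ^ 2) (bf ^ 3 * qf ^ 2)"
    "fract_cong p (qf * qf ^ 4 / (af * qf)) (qf * qf ^ 4 / (af * qf))"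
    "fract_cong p (qf * (af * qf) * qf ^ 2) (qf * (af * qf) * qf ^ 2)"
    by (intro i fract_unit_mult[OF p] fract_unit_divide[OF p] fract_unit_power[OF p] gu)+
  show ?thesis
    unfolding step_cofactor_def
    by (rule fract_cong_divide[OF p _ _ den];
        intro fract_cong_mult[OF p _ fract_cong_power[OF p u]] fract_cong_mult[OF p _ u] a fract_cong_mult[OF p]
          fract_cong_diff[OF p] fract_cong_1[OF p] u)
qed

lemma is_unit_of_nat: "N > 0 \<Longrightarrow> is_unit (of_nat N :: qab_poly)"
  by (simp add: of_nat_poly is_unit_const_poly_iff dvd_field_iff)

lemma to_fract_of_nat: "to_fract (of_nat N) = of_nat N"
  by (induction N) simp_all

text \<open>\<open>d\<close> is the order of q modulo p. In the application it is odd as a divisor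
  of n, and exceeds 1 because p does not divide 1 - q.\<close>

locale qint_prime =
  fixes p :: qab_poly and d :: nat
  assumes generic: "generic_prime p" and d: "odd d" "d > 1"
    and dvd_iff: "\<And>j. p dvd 1 - q_poly ^ j \<longleftrightarrow> d dvd j"
begin

lemma prime_elem_p: "prime_elem p"
  using generic by (simp add: generic_prime_def)

lemma cong_1: "fract_cong p (qf ^ (l * d)) 1"
  using fract_cong_dvd[OF prime_elem_p, of 1 "q_poly ^ (l * d)"] dvd_iff[of "l * d"]
  by (simp add: to_fract_power fract_cong_sym)

lemma cong_shift: "fract_cong p (qf ^ (c * (l * d + j))) (qf ^ (c * j))"
proof -
  have "qf ^ (c * (l * d + j)) = qf ^ (c * l * d) * qf ^ (c * j)"
    by (simp add: distrib_left power_add mult.assoc)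
  then show ?thesis
    using fract_cong_mult[OF prime_elem_p cong_1[of "c * l"] fract_cong_power[OF prime_elem_p fract_cong_q[OF prime_elem_p], of "c * j"]] by simp
qed

lemma unit_iff: "\<not> d dvd j \<Longrightarrow> fract_unit p (1 - qf ^ j)"
  by (rule fract_unit_of_not_dvd[OF prime_elem_p]) (simp add: dvd_iff)

text \<open>Modulo d the number is 4(j + 1), where d is prime to 4 and j + 1 < d. Hence p divides
  none of the factors 1 - q^(4i+4) of a block before the last one.\<close>

lemma order_not_dvd: "k < d \<Longrightarrow> j < k \<Longrightarrow> \<not> d dvd 4 * (l * d + j) + 4"
proof
  assume j: "k < d" "j < k" and "d dvd 4 * (l * d + j) + 4"
  then have "d dvd 4 * (j + 1) + d * (4 * l)" by (simp add: algebra_simps)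
  then have "d dvd 4 * (j + 1)" by (metis dvd_add_left_iff dvd_triv_left)
  moreover have "coprime d 4"
  proof -
    have "coprime d 2" using d(1) by (simp add: coprime_right_2_iff_odd)
    then have "coprime d (2 * 2)" by (simp only: coprime_mult_right_iff simp_thms)
    then show ?thesis by simp
  qed
  ultimately have "d dvd j + 1" using coprime_dvd_mult_right_iff by blast
  then show False using j by (auto dest: dvd_imp_le)
qed

text \<open>Both sides of the quotient contain 1 - q^d. Once it is cancelled, q^d congruent to 1
  turns the geometric sums into the integers 2l + 1 and 4(l + 1), and the second is a unit in
  characteristic 0.\<close>

lemma power_quotient_integral:
  "fract_cong p ((1 - qf ^ ((2 * l + 1) * d)) / (1 - qf ^ (4 * (l + 1) * d)))
     ((1 - qf ^ ((2 * l + 1) * d)) / (1 - qf ^ (4 * (l + 1) * d)))"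
proof -
  define y where "y = qf ^ d"
  have y: "1 - y \<noteq> 0" using qf_power_neq_1[of d] d by (simp add: y_def)
  have y1: "fract_cong p y 1" using cong_1[of 1] by (simp add: y_def)
  have S: "1 - qf ^ (k * d) = (1 - y) * (\<Sum>i<k. y ^ i)" for k
    unfolding one_diff_power_eq[symmetric] y_def by (simp add: mult.commute flip: power_mult)
  have c: "fract_cong p (\<Sum>i<k. y ^ i) (of_nat k)" for k
    using fract_cong_sum[OF prime_elem_p, of "{..<k}" "\<lambda>i. y ^ i" "\<lambda>i. 1 ^ i"] fract_cong_power[OF prime_elem_p y1] by simp
  have "\<not> p dvd of_nat (4 * (l + 1))"
  proof
    assume "p dvd of_nat (4 * (l + 1))"
    then have "p dvd 1" by (rule dvd_trans) (rule is_unit_of_nat, simp)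
    then show False using prime_elem_p by (simp add: prime_elem_def)
  qed
  from fract_unit_to_fract[OF prime_elem_p this] have "fract_unit p (of_nat (4 * (l + 1)))"
    unfolding to_fract_of_nat .
  then have u: "fract_unit p (\<Sum>i<4 * (l + 1). y ^ i)"
    using fract_unit_cong[OF prime_elem_p fract_cong_sym[OF c]] by blast
  have i: "fract_cong p (\<Sum>i<k. y ^ i) (\<Sum>i<k. y ^ i)" for k
    using fract_cong_trans[OF prime_elem_p c fract_cong_sym[OF c]] .
  show ?thesis
    unfolding S mult_divide_mult_cancel_left[OF y] by (rule fract_cong_divide[OF prime_elem_p i i u])
qed

text \<open>When \<open>k\<close> runs over a block of length \<open>d\<close>, exactly one factor \<open>1 - q\<^sup>2\<^sup>k\<^sup>+\<^sup>1\<close> of the numerator and one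
  factor \<open>1 - q\<^sup>4\<^sup>k\<^sup>+\<^sup>4\<close> of the denominator are divisible by \<open>p\<close>, and their quotient is integral.\<close>

lemma core_ratio_integral: "fract_cong p (core_ratio (l * d)) (core_ratio (l * d))"
proof (induction l)
  case 0
  show ?case using fract_cong_1[OF prime_elem_p] by (simp add: core_ratio_0)
next
  case (Suc l)
  define f where "f j = 1 - qf ^ (2 * (l * d + j) + 1)" for j
  define h where "h j = 1 - qf ^ (4 * (l * d + j) + 4)" for j
  define s where "s j = step_cofactor (qf ^ (2 * (l * d + j)))" for j
  \<comment> \<open>2 j0 + 1 = d, so \<open>f j0\<close> is 1 - q^((2l+1)d); its partner is the last
    factor of the block, 1 - q^(4(l+1)d), at index d - 1.\<close>
  define j0 where "j0 = (d - 1) div 2"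
  have j0: "j0 < d" "2 * (l * d + j0) + 1 = (2 * l + 1) * d"
    unfolding j0_def using d by (auto elim!: oddE simp: algebra_simps)
  obtain d' where d': "d = Suc d'" using d by (cases d) auto
  have hd: "4 * (l * d + d') + 4 = 4 * (l + 1) * d" unfolding d' by (simp add: algebra_simps)
  have "(\<Prod>j<d. f j) = f j0 * (\<Prod>j\<in>{..<d} - {j0}. f j)"
    using j0 by (intro prod.remove) auto
  moreover have "(\<Prod>j<d. h j) = (\<Prod>j<d'. h j) * h d'"
    unfolding d' by simp
  moreover have "core_ratio (Suc l * d) = core_ratio (l * d) * ((\<Prod>j<d. f j) / (\<Prod>j<d. h j) * (\<Prod>j<d. s j))"
    using core_ratio_add[of "l * d" d]
    by (simp add: f_def h_def s_def prod_dividef prod.distrib add.commute)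
  ultimately have "core_ratio (Suc l * d) = core_ratio (l * d) *
      (f j0 / h d' * ((\<Prod>j\<in>{..<d} - {j0}. f j) / (\<Prod>j<d'. h j)) * (\<Prod>j<d. s j))"
    by simp
  moreover have "f j0 / h d' = (1 - qf ^ ((2 * l + 1) * d)) / (1 - qf ^ (4 * (l + 1) * d))"
    unfolding f_def h_def j0(2) hd ..
  moreover have "fract_unit p (\<Prod>j<d'. h j)"
    unfolding h_def by (intro fract_unit_prod[OF prime_elem_p] unit_iff order_not_dvd[of d']) (simp_all add: d')
  moreover have "fract_cong p (f j) (f j)" for j
    unfolding f_def by (intro fract_cong_diff[OF prime_elem_p] fract_cong_1[OF prime_elem_p] fract_cong_power[OF prime_elem_p] fract_cong_q[OF prime_elem_p])
  moreover have "fract_cong p (s j) (s j)" for j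
    unfolding s_def by (intro fract_cong_step_cofactor[OF generic] fract_cong_power[OF prime_elem_p] fract_cong_q[OF prime_elem_p])
  ultimately have prods: "fract_cong p ((\<Prod>j\<in>{..<d} - {j0}. f j) / (\<Prod>j<d'. h j)) ((\<Prod>j\<in>{..<d} - {j0}. f j) / (\<Prod>j<d'. h j))"
    "fract_cong p (\<Prod>j<d. s j) (\<Prod>j<d. s j)"
    and eq: "core_ratio (Suc l * d) = core_ratio (l * d) *
      ((1 - qf ^ ((2 * l + 1) * d)) / (1 - qf ^ (4 * (l + 1) * d))
        * ((\<Prod>j\<in>{..<d} - {j0}. f j) / (\<Prod>j<d'. h j)) * (\<Prod>j<d. s j))"
    by (auto intro: fract_cong_divide[OF prime_elem_p] fract_cong_prod[OF prime_elem_p] fract_unit_imp_cong[OF prime_elem_p])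
  show ?case
    unfolding eq
    by (intro fract_cong_mult[OF prime_elem_p Suc.IH] fract_cong_mult[OF prime_elem_p _ prods(2)]
        fract_cong_mult[OF prime_elem_p power_quotient_integral prods(1)])
qed

text \<open>Inside a block the step factors have unit denominators and involve the position of the
  block only through powers of q^d, which are 1 modulo p. Passing from the first block to another
  therefore changes only the starting value \<open>core_ratio (l * d)\<close>.\<close>

lemma quad_term_shift_cong:
  assumes "k < d"
  shows "fract_cong p (quad_term qf qf (af * qf) (bf ^ 3) (l * d + k))
     (core_ratio (l * d) * quad_term qf qf (af * qf) (bf ^ 3) k)"
proof -
  have a: "fract_cong p (1 - qf * qf ^ (6 * (l * d + k))) (1 - qf * qf ^ (6 * k))"
    by (intro fract_cong_diff[OF prime_elem_p] fract_cong_1[OF prime_elem_p] fract_cong_mult[OF prime_elem_p] fract_cong_q[OF prime_elem_p] cong_shift)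
  \<comment> \<open>The terms \<open>0 + j\<close> on the right match \<open>core_ratio_add\<close>
    with offset 0, just as the left side matches it with offset \<open>l * d\<close>.\<close>
  have "fract_cong p ((1 - qf ^ (2 * (l * d + j) + 1)) / (1 - qf ^ (4 * (l * d + j) + 4)) * step_cofactor (qf ^ (2 * (l * d + j))))
     ((1 - qf ^ (2 * (0 + j) + 1)) / (1 - qf ^ (4 * (0 + j) + 4)) * step_cofactor (qf ^ (2 * (0 + j))))" if "j < k" for j
  proof -
    have "fract_unit p (1 - qf ^ (4 * (l * d + j) + 4))"
      by (intro unit_iff order_not_dvd[OF assms that])
    then show ?thesis
      unfolding power_add add_0_left
      by (intro fract_cong_mult[OF prime_elem_p] fract_cong_divide[OF prime_elem_p] fract_cong_diff[OF prime_elem_p] fract_cong_1[OF prime_elem_p]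
          fract_cong_step_cofactor[OF generic] fract_cong_power[OF prime_elem_p] fract_cong_q[OF prime_elem_p] cong_shift)
  qed
  then have "fract_cong p
      (\<Prod>j<k. (1 - qf ^ (2 * (l * d + j) + 1)) / (1 - qf ^ (4 * (l * d + j) + 4)) * step_cofactor (qf ^ (2 * (l * d + j))))
      (\<Prod>j<k. (1 - qf ^ (2 * (0 + j) + 1)) / (1 - qf ^ (4 * (0 + j) + 4)) * step_cofactor (qf ^ (2 * (0 + j))))"
    by (intro fract_cong_prod[OF prime_elem_p]) (simp only: lessThan_iff)
  from fract_cong_mult[OF prime_elem_p core_ratio_integral[of l] this]
  have "fract_cong p (core_ratio (l * d + k)) (core_ratio (l * d) * core_ratio (0 + k))"
    unfolding core_ratio_add core_ratio_0 mult_1 .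
  from fract_cong_mult[OF prime_elem_p a this] show ?thesis
    unfolding quad_term_core_ratio by (simp add: mult.left_commute)
qed

text \<open>For k < d all denominators are units, so the leading parameter may be changed to
  q^(1-d), together with the parameters computed from it, while the base stays q. The resulting sum
  is zero as a rational function, as the base is not a root of unity there.\<close>

lemma block_sum_cong_0: "fract_cong p (\<Sum>k<d. quad_term qf qf (af * qf) (bf ^ 3) k) 0"
proof -
  define N where "N = (d - 1) div 2"
  have N: "d = Suc (2 * N)" "N < d" unfolding N_def using d by (auto elim!: oddE)
  have "fract_cong p (qf ^ d / qf ^ (2 * N)) (1 / qf ^ (2 * N))"
    using cong_1[of 1] generic_prime_units(1)[OF generic]
    by (intro fract_cong_divide[OF prime_elem_p] fract_unit_imp_cong[OF prime_elem_p] fract_unit_power[OF prime_elem_p]) simp_all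
  moreover have "qf ^ d / qf ^ (2 * N) = qf"
    using indeterminates_nonzero N(1) by simp
  ultimately have A: "fract_cong p qf (1 / qf ^ (2 * N))" by simp
  have B: "fract_cong p (af * qf) (af * qf)" "fract_cong p (bf ^ 3) (bf ^ 3)"
    by (intro fract_unit_imp_cong[OF prime_elem_p] fract_unit_mult[OF prime_elem_p] fract_unit_power[OF prime_elem_p] generic_prime_units[OF generic])+
  have "fract_cong p (\<Sum>k<d. quad_term qf qf (af * qf) (bf ^ 3) k)
      (\<Sum>k<d. quad_term qf (1 / qf ^ (2 * N)) (af * qf) (bf ^ 3) k)"
  proof (intro fract_cong_sum[OF prime_elem_p] fract_cong_summand[OF generic A B])
    fix k j assume "k \<in> {..<d}" "j < k"
    then show "\<not> p dvd 1 - q_poly ^ (4 + 4 * j)"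
      using order_not_dvd[of k j 0] by (simp add: dvd_iff add.commute)
  qed
  moreover have "(\<Sum>k<d. quad_term qf (1 / qf ^ (2 * N)) (af * qf) (bf ^ 3) k) = 0"
    using indeterminates_nonzero
    by (intro sum_quad_term_base_eq_0 qf_power_inj bf_generic af_generic N(2)) simp_all
  ultimately show ?thesis by simp
qed

lemma lhs_sum_cong_0:
  assumes "d dvd n"
  shows "fract_cong p (lhs_sum n) 0"
proof -
  obtain m where m: "n = m * d" using assms by (metis dvd_def mult.commute)
  have "fract_cong p (\<Sum>k<d. quad_term qf qf (af * qf) (bf ^ 3) (l * d + k)) 0" for l
  proof -
    have "fract_cong p (\<Sum>k<d. quad_term qf qf (af * qf) (bf ^ 3) (l * d + k))
        (\<Sum>k<d. core_ratio (l * d) * quad_term qf qf (af * qf) (bf ^ 3) k)"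
      by (intro fract_cong_sum[OF prime_elem_p] quad_term_shift_cong) simp
    moreover have "fract_cong p (\<Sum>k<d. core_ratio (l * d) * quad_term qf qf (af * qf) (bf ^ 3) k) 0"
      unfolding sum_distrib_left[symmetric]
      using fract_cong_mult[OF prime_elem_p core_ratio_integral block_sum_cong_0] by simp
    ultimately show ?thesis using fract_cong_trans[OF prime_elem_p] by blast
  qed
  then have "fract_cong p (\<Sum>l<m. \<Sum>k<d. quad_term qf qf (af * qf) (bf ^ 3) (l * d + k)) (\<Sum>l<m. 0)"
    by (rule fract_cong_sum[OF prime_elem_p])
  moreover have "(\<Sum>l<m. \<Sum>k<d. quad_term qf qf (af * qf) (bf ^ 3) (l * d + k))
      = (\<Sum>k<n. quad_term qf qf (af * qf) (bf ^ 3) k)"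
    unfolding m sum.nat_group[symmetric] by (simp add: sum.atLeastLessThan_shift_0 atLeast0LessThan)
  ultimately have "fract_cong p (\<Sum>k<n. quad_term qf qf (af * qf) (bf ^ 3) k) 0" by simp
  moreover have "fract_unit p (1 - qf)"
    using unit_iff[of 1] d by simp
  ultimately show ?thesis
    unfolding lhs_sum_def using fract_cong_divide[OF prime_elem_p _ fract_unit_imp_cong[OF prime_elem_p]] by force
qed

end

text \<open>q is invertible modulo p, so exponents can be reduced modulo the least positive d for
  which p divides 1 - q^d; minimality leaves remainder 0.\<close>

lemma qint_prime_order:
  assumes g: "generic_prime p" and n: "p dvd 1 - q_poly ^ n" "odd n" and nd: "\<not> p dvd 1 - q_poly"
  obtains d where "qint_prime p d" "d dvd n"
proof -
  have p: "prime_elem p" using g by (simp add: generic_prime_def)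
  define d where "d = (LEAST d. d > 0 \<and> p dvd 1 - q_poly ^ d)"
  have "n > 0 \<and> p dvd 1 - q_poly ^ n" using n odd_pos by blast
  then have d: "d > 0" "p dvd 1 - q_poly ^ d"
    unfolding d_def by (metis (mono_tags, lifting) LeastI)+
  have least: "r = 0" if "r < d" "p dvd 1 - q_poly ^ r" for r
  proof -
    have "\<not> (r > 0 \<and> p dvd 1 - q_poly ^ r)"
      using that(1) unfolding d_def by (rule not_less_Least)
    then show ?thesis using that(2) by simp
  qed
  have mult: "p dvd 1 - q_poly ^ (d * t)" for t
  proof -
    have "1 - q_poly ^ d dvd 1 - q_poly ^ (d * t)"
      unfolding power_mult one_diff_power_eq[of _ t] by simp
    then show ?thesis using d(2) dvd_trans by blast
  qed
  have iff: "p dvd 1 - q_poly ^ j \<longleftrightarrow> d dvd j" for j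
  proof
    assume "p dvd 1 - q_poly ^ j"
    have "q_poly ^ j = q_poly ^ (d * (j div d)) * q_poly ^ (j mod d)"
      by (simp flip: power_add)
    then have "1 - q_poly ^ j - (1 - q_poly ^ (d * (j div d))) = q_poly ^ (d * (j div d)) * (1 - q_poly ^ (j mod d))"
      by (simp add: algebra_simps)
    then have "p dvd q_poly ^ (d * (j div d)) * (1 - q_poly ^ (j mod d))"
      using dvd_diff[OF \<open>p dvd 1 - q_poly ^ j\<close> mult] by metis
    moreover have "\<not> p dvd q_poly ^ i" for i
      using g p prime_elem_dvd_power unfolding generic_prime_def by blast
    ultimately have "p dvd 1 - q_poly ^ (j mod d)"
      using p by (simp add: prime_elem_dvd_mult_iff)
    then show "d dvd j" using least[of "j mod d"] d(1) by (simp add: mod_eq_0_iff_dvd)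
  qed (use mult in auto)
  have "d dvd n" using iff n by blast
  then have "odd d" using n(2) dvd_trans by blast
  moreover have "d \<noteq> 1" using d(2) nd by auto
  ultimately show ?thesis
    using that[of d] \<open>d dvd n\<close> g iff d(1) by (simp add: qint_prime_def)
qed

section \<open>Vanishing of both sides at the primes of [n], and assembly\<close>

lemma fract_cong_modulo_qint:
  assumes p: "prime p" "p dvd qint q_poly n" and n: "n mod 4 = 3"
  shows "fract_cong p (lhs_sum n) (rhs_total n)"
proof -
  have odd: "odd n" and n0: "n > 0" using n by presburger+
  note g = generic_prime_qint(1)[OF p n0] and nd = generic_prime_qint(2)[OF p n0]
    and pn = generic_prime_qint(3)[OF p n0]
  have pe: "prime_elem p" using p by simp
  obtain d where "qint_prime p d" "d dvd n"
    using qint_prime_order[OF g pn odd nd] .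
  then have lhs: "fract_cong p (lhs_sum n) 0"
    by (rule qint_prime.lhs_sum_cong_0)
  define m where "m = (n + 1) div 4"
  define M where "M = (3 * n - 1) div 4"
  define j where "j = (n - 3) div 4"
  have m: "4 * m - 1 = n" "0 < m" and j: "n = 3 + 4 * j" "j < M"
  proof -
    define k where "k = n div 4"
    have "n = 4 * k + 3" unfolding k_def using n by (metis mult_div_mod_eq)
    then have "m = k + 1" "M = 3 * k + 2" "j = k" "n = 4 * k + 3"
      unfolding m_def M_def j_def by simp_all
    then show "4 * m - 1 = n" "0 < m" "n = 3 + 4 * j" "j < M" by simp_all
  qed
  have qn: "fract_cong p (1 - qf ^ n) 0"
    using fract_cong_of_dvd[OF pe pn] by (simp add: to_fract_power)
  note u = fract_unit_1_minus_inverse_q(2)[OF g nd]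
  have "fract_cong p ((1 - qf ^ n) / (1 - 1 / qf)) 0"
    using fract_cong_divide[OF pe qn fract_unit_imp_cong[OF pe u] u] by simp
  \<comment> \<open>Since 4m - 1 = n, the telescoped quotient in \<open>rhs_b_alt\<close> is the one
    just shown to vanish.\<close>
  then have b0: "fract_cong p (rhs_b m) 0"
    unfolding rhs_b_alt[OF m(2)] m(1)
    by (intro fract_cong_0_mult[OF pe] fract_cong_rhs_b_cofactor[OF g])
  \<comment> \<open>n = 3 + 4j with j < M, so 1 - q^n is itself one of the factors of
    (q^3;q^4)_M.\<close>
  have "qpoch (qf ^ 3) (qf ^ 4) M = (1 - qf ^ n) * (\<Prod>i\<in>{..<M} - {j}. 1 - qf ^ 3 * (qf ^ 4) ^ i)"
    unfolding qpoch_def j(1) power_add power_mult using j(2) by (intro prod.remove) auto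
  moreover have "fract_cong p \<dots> 0"
    by (intro fract_cong_0_mult[OF pe] qn fract_cong_prod[OF pe] fract_cong_diff[OF pe] fract_cong_1[OF pe]
        fract_cong_mult[OF pe] fract_cong_power[OF pe] fract_cong_q[OF pe])
  ultimately have "fract_cong p (qpoch (qf ^ 3) (qf ^ 4) M) 0" by simp
  then have "fract_cong p (qpoch (qf ^ 3) (qf ^ 4) M * qpoch (qf ^ 5) (qf ^ 4) M) 0"
    by (intro fract_cong_0_mult[OF pe] fract_cong_qpoch[OF pe] fract_cong_power[OF pe] fract_cong_q[OF pe])
  from fract_cong_divide[OF pe this fract_unit_imp_cong[OF pe fract_unit_rhs_a_den[OF g]] fract_unit_rhs_a_den[OF g]]
  have a0: "fract_cong p (rhs_a M) 0"
    unfolding rhs_a_def by simp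
  have pol: "fract_cong p ((bf - qf ^ n) * (af * bf - 1 - af ^ 2 + af * qf ^ n)) ((bf - qf ^ n) * (af * bf - 1 - af ^ 2 + af * qf ^ n))"
    "fract_cong p ((1 - af * qf ^ n) * (af - qf ^ n)) ((1 - af * qf ^ n) * (af - qf ^ n))"
    using fract_cong_to_fract[OF pe, of "(b_poly - q_poly ^ n) * (a_poly * b_poly - 1 - a_poly ^ 2 + a_poly * q_poly ^ n)"]
      fract_cong_to_fract[OF pe, of "(1 - a_poly * q_poly ^ n) * (a_poly - q_poly ^ n)"]
    by (simp_all add: to_fract_power)
  have "fract_cong p (rhs_total n) 0"
    unfolding rhs_total_def m_def[symmetric] M_def[symmetric]
    using fract_cong_add[OF pe fract_cong_mult[OF pe fract_cong_crt(2)[OF g pol(1)] b0]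
        fract_cong_mult[OF pe fract_cong_crt(2)[OF g pol(2)] a0]] by simp
  then show ?thesis
    using fract_cong_trans[OF pe lhs] fract_cong_sym by blast
qed

lemma fract_cong_modulus:
  assumes "prime p" "p dvd modulus n" "n mod 4 = 3"
  shows "fract_cong p (lhs_sum n) (rhs_total n)"
  using assms fract_cong_modulo_a_factors fract_cong_modulo_b_factor fract_cong_modulo_qint unfolding modulus_def by (auto simp: prime_dvd_mult_iff)

lemma summand_eq_quad_term:
  "qint qf (6 * k + 1)
      * ((qpoch qf (qf ^ 2) k * qpoch (af * qf) (qf ^ 2) k * qpoch (qf / af) (qf ^ 2) k
            * qpoch (qf / bf ^ 3) (qf ^ 4) k)
         / (qpoch (qf ^ 4) (qf ^ 4) k * qpoch (qf ^ 4 / af) (qf ^ 4) k * qpoch (af * qf ^ 4) (qf ^ 4) k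
            * qpoch (bf ^ 3 * qf ^ 2) (qf ^ 2) k))
      * qf ^ (k ^ 2 + k) * bf ^ (3 * k)
    = quad_term qf qf (af * qf) (bf ^ 3) k / (1 - qf)"
proof -
  have e: "qf ^ 2 / (af * qf) = qf / af" "qf * qf ^ 4 / (af * qf) = qf ^ 4 / af"
    "qf * (af * qf) * qf ^ 2 = af * qf ^ 4" "qf ^ (6 * k + 1) = qf * qf ^ (6 * k)"
    "bf ^ (3 * k) = (bf ^ 3) ^ k"
    using indeterminates_nonzero power_mult[of bf 3 k] by (simp_all add: eval_nat_numeral)
  show ?thesis
    unfolding quad_term_def quad_core_def quad_den_def qint_def e by (simp add: mult_ac)
qed

theorem theorem2p1:
  fixes n :: nat and q a b :: qab_ratfun
  assumes "n > 0" and "n mod 4 = 3"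
  defines "q \<equiv> Fract q_poly 1" and "a \<equiv> Fract a_poly 1" and "b \<equiv> Fract b_poly 1"
  shows "ratfun_cong
    (\<Sum>k = 0..n - 1.
        qint q (6 * k + 1)
      * ((qpoch q (q ^ 2) k * qpoch (a * q) (q ^ 2) k * qpoch (q / a) (q ^ 2) k
            * qpoch (q / b ^ 3) (q ^ 4) k)
         / (qpoch (q ^ 4) (q ^ 4) k * qpoch (q ^ 4 / a) (q ^ 4) k * qpoch (a * q ^ 4) (q ^ 4) k
            * qpoch (b ^ 3 * q ^ 2) (q ^ 2) k))
      * q ^ (k ^ 2 + k) * b ^ (3 * k))
    ((b - q ^ n) * (a * b - 1 - a ^ 2 + a * q ^ n) / ((a - b) * (1 - a * b))
       * ((qpoch (q ^ 3) (q ^ 4) ((n + 1) div 4) * qpoch (1 / b ^ 3) (q ^ 4) ((n + 1) div 4))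
          / (qpoch (1 / q) (q ^ 4) ((n + 1) div 4)
             * qpoch (b ^ 3 * q ^ 2) (q ^ 4) ((n + 1) div 4)))
       * (b ^ 3 / q) ^ ((n + 1) div 4)
     + (1 - a * q ^ n) * (a - q ^ n) / ((a - b) * (1 - a * b))
       * ((qpoch (q ^ 3) (q ^ 4) ((3 * n - 1) div 4) * qpoch (q ^ 5) (q ^ 4) ((3 * n - 1) div 4))
          / (qpoch (a * q ^ 4) (q ^ 4) ((3 * n - 1) div 4)
             * qpoch (q ^ 4 / a) (q ^ 4) ((3 * n - 1) div 4))))
    (qint q_poly n * (1 - a_poly * q_poly ^ n) * (a_poly - q_poly ^ n) * (b_poly - q_poly ^ n))"
proof -
  have qab: "q = qf" "a = af" "b = bf"
    by (simp_all add: q_def a_def b_def to_fract_def)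
  have "{0..n - 1} = {..<n}" using \<open>n > 0\<close> by auto
  then have "ratfun_cong
      (\<Sum>k = 0..n - 1. quad_term qf qf (af * qf) (bf ^ 3) k / (1 - qf)) (rhs_total n) (modulus n)"
    using ratfun_congI[OF squarefree_modulus[OF \<open>n > 0\<close>] fract_cong_modulus[OF _ _ \<open>n mod 4 = 3\<close>]]
    by (simp add: lhs_sum_def sum_divide_distrib)
  then show ?thesis
    unfolding qab summand_eq_quad_term rhs_total_def rhs_a_def rhs_b_def modulus_def
    by (simp only: mult.assoc)
qed

end
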